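(* Let $\mathcal{D}$ be a triangulated category with two $t$-structures $s_1=(\mathcal{C}_1^{\leqslant 0},\mathcal{C}_1^{\geqslant 0})$ and $s_2=(\mathcal{C}_2^{\leqslant 0},\mathcal{C}_2^{\geqslant 0})$ such that $\mathcal{C}_1^{\leqslant 0}\subseteq\mathcal{C}_2^{\leqslant 0}$. Let $\mathcal{H}_{[s_1,s_2]}=\mathcal{C}_2^{\leqslant 0}\cap\mathcal{C}_1^{\geqslant 1}$. Denote by $\mathsf{tors}[s_1,s_2]$ the set of torsion pairs $t$ in $\mathcal{D}$ with $(\mathcal{C}_1^{\leqslant 0},\mathcal{C}_1^{\geqslant 1})\preccurlyeq t\preccurlyeq(\mathcal{C}_2^{\leqslant 0},\mathcal{C}_2^{\geqslant 1})$, by $\mathsf{t\text{-}str}[s_1,s_2]$ the set of $t$-structures $(\mathcal{D}^{\leqslant 0},\mathcal{D}^{\geqslant 0})$ on $\mathcal{D}$ such that $\mathcal{C}_1^{\leqslant 0}\subseteq\mathcal{D}^{\leqslant 0}\subseteq\mathcal{C}_2^{\leqslant 0}$, and by $\mathsf{tors}\,\mathcal{H}_{[s_1,s_2]}$ (resp. $\mathsf{s\text{-}tors}\,\mathcal{H}_{[s_1,s_2]}$) the set of torsion pairs (resp. $s$-torsion pairs) in $\mathcal{H}_{[s_1,s_2]}$. Then there are the following order preserving, mutually inverse bijections. (1) $\phi:\mathsf{tors}[s_1,s_2]\rightleftarrows\mathsf{tors}\,\mathcal{H}_{[s_1,s_2]}:\psi$, where $\phi(\mathcal{U},\mathcal{V})=(\mathcal{U}\cap\mathcal{C}_1^{\geqslant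 1},\mathcal{V}\cap\mathcal{C}_2^{\leqslant 0})$ and $\psi(\mathcal{T},\mathcal{F})=(\mathcal{C}_1^{\leqslant 0}*\mathcal{T},\mathcal{F}*\mathcal{C}_2^{\geqslant 1})$. (2) $\phi:\mathsf{t\text{-}str}[s_1,s_2]\rightleftarrows\mathsf{s\text{-}tors}\,\mathcal{H}_{[s_1,s_2]}:\psi$, where $\phi(\mathcal{D}^{\leqslant 0},\mathcal{D}^{\geqslant 0})=(\mathcal{D}^{\leqslant 0}\cap\mathcal{C}_1^{\geqslant 1},\mathcal{D}^{\geqslant 1}\cap\mathcal{C}_2^{\leqslant 0})$ and $\psi(\mathcal{T},\mathcal{F})=(\mathcal{C}_1^{\leqslant 0}*\mathcal{T},\mathcal{F}[1]*\mathcal{C}_2^{\geqslant 0})$.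
   Context: All categories are skeletally small; all subcategories are full and closed under isomorphisms. $[1]$ is the shift functor of $\mathcal{D}$. For subcategories $\mathcal{X},\mathcal{Y}$ of $\mathcal{D}$, $\mathcal{X}*\mathcal{Y}$ is the subcategory of objects $A$ admitting a distinguished triangle $X\to A\to Y\to X[1]$ with $X\in\mathcal{X}$, $Y\in\mathcal{Y}$. A $t$-structure on $\mathcal{D}$ is a pair $(\mathcal{D}^{\leqslant 0},\mathcal{D}^{\geqslant 0})$ of subcategories such that, writing $\mathcal{D}^{\leqslant n}=\mathcal{D}^{\leqslant 0}[-n]$, $\mathcal{D}^{\geqslant n}=\mathcal{D}^{\geqslant 0}[-n]$ (similarly for $\mathcal{C}_i$): $\mathcal{D}(\mathcal{D}^{\leqslant 0},\mathcal{D}^{\geqslant 1})=0$, $\mathcal{D}=\mathcal{D}^{\leqslant 0}*\mathcal{D}^{\geqslant 1}$, $\mathcal{D}^{\leqslant 0}\subseteq\mathcal{D}^{\leqslant 1}$, $\mathcal{D}^{\geqslant 1}\subseteq\mathcal{D}^{\geqslant 0}$. Let $\mathcal{K}$ be $\mathcal{D}$ or an extension-closed subcategory of $\mathcal{D}$ (such as $\mathcal{H}_{[s_1,s_2]}$), regarded as an extriangulated category with negative first extension $\mathbb{E}^{-1}(-,-)=\mathcal{D}(-,-[-1])$. A torsion pair in $\mathcal{K}$ is a pair $(\mathcal{T},\mathcal{F})$ of additive subcategories of $\mathcal{K}$ closed under direct sums and direct summands with $\mathcal{D}(\mathcal{T},\mathcal{F})=0$ and such that every $X\in\mathcal{K}$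 admits a distinguished triangle $T\to X\to F\to T[1]$ with $T\in\mathcal{T}$, $F\in\mathcal{F}$. It is an $s$-torsion pair if moreover $\mathcal{D}(\mathcal{T},\mathcal{F}[-1])=0$. For torsion pairs in $\mathcal{K}$, $(\mathcal{T}_1,\mathcal{F}_1)\preccurlyeq(\mathcal{T}_2,\mathcal{F}_2)$ means $\mathcal{D}(\mathcal{T}_1,\mathcal{F}_2)=0$ and $\mathcal{D}(\mathcal{T}_1,\mathcal{F}_2[-1])=0$. On $s$-torsion pairs $\preccurlyeq$ is inclusion of first components; and a torsion pair $(\mathcal{U},\mathcal{V})$ of $\mathcal{D}$ lies in $\mathsf{tors}[s_1,s_2]$ iff $\mathcal{C}_1^{\leqslant 0}\subseteq\mathcal{U}\subseteq\mathcal{C}_2^{\leqslant 0}$. $t$-structures are ordered by inclusion of aisles $\mathcal{D}^{\leqslant 0}$; order preserving for sets of torsion pairs means preserving $\preccurlyeq$. *)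

theory Defs
  imports "HOL-Algebra.Group"
begin

section \<open>Additive categories\<close>

text \<open>
  The Hom-sets of a category are pairwise disjoint: every arrow knows its domain and codomain.
  \<open>g \<cdot> f\<close> is the composite "first f, then g". Values of the operations outside the carriers
  \<open>Ob\<close> and \<open>Arr\<close>, or on non-composable or non-parallel arrows, are irrelevant.
\<close>

record ('o, 'm) cat =
  Ob :: "'o set"
  Arr :: "'m set"
  Dom :: "'m \<Rightarrow> 'o"
  Cod :: "'m \<Rightarrow> 'o"
  Id :: "'o \<Rightarrow> 'm"
  Comp :: "'m \<Rightarrow> 'm \<Rightarrow> 'm"  (infixl "\<cdot>\<index>" 70)

definition Hom :: "('o, 'm, 'z) cat_scheme \<Rightarrow> 'o \<Rightarrow> 'o \<Rightarrow> 'm set" where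
  "Hom C X Y = {f \<in> Arr C. Dom C f = X \<and> Cod C f = Y}"

locale category =
  fixes C :: "('o, 'm, 'z) cat_scheme" (structure)
  assumes Dom_in_Ob: "f \<in> Arr C \<Longrightarrow> Dom C f \<in> Ob C"
    and Cod_in_Ob: "f \<in> Arr C \<Longrightarrow> Cod C f \<in> Ob C"
    and Id_in_Hom: "X \<in> Ob C \<Longrightarrow> Id C X \<in> Hom C X X"
    and Comp_in_Hom: "\<lbrakk>f \<in> Hom C X Y; g \<in> Hom C Y Z\<rbrakk> \<Longrightarrow> g \<cdot> f \<in> Hom C X Z"
    and Comp_Id_right: "f \<in> Hom C X Y \<Longrightarrow> f \<cdot> Id C X = f"
    and Comp_Id_left: "f \<in> Hom C X Y \<Longrightarrow> Id C Y \<cdot> f = f"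
    and Comp_assoc: "\<lbrakk>f \<in> Hom C W X; g \<in> Hom C X Y; h \<in> Hom C Y Z\<rbrakk>
      \<Longrightarrow> (h \<cdot> g) \<cdot> f = h \<cdot> (g \<cdot> f)"

definition is_iso :: "('o, 'm, 'z) cat_scheme \<Rightarrow> 'o \<Rightarrow> 'o \<Rightarrow> 'm \<Rightarrow> bool" where
  "is_iso C X Y f \<longleftrightarrow> f \<in> Hom C X Y \<and>
     (\<exists>g \<in> Hom C Y X. g \<cdot>\<^bsub>C\<^esub> f = Id C X \<and> f \<cdot>\<^bsub>C\<^esub> g = Id C Y)"

definition isomorphic :: "('o, 'm, 'z) cat_scheme \<Rightarrow> 'o \<Rightarrow> 'o \<Rightarrow> bool" where
  "isomorphic C X Y \<longleftrightarrow> (\<exists>f. is_iso C X Y f)"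

record ('o, 'm) addcat = "('o, 'm) cat" +
  AddA :: "'m \<Rightarrow> 'm \<Rightarrow> 'm"
  ZeroA :: "'o \<Rightarrow> 'o \<Rightarrow> 'm"

definition HomGroup :: "('o, 'm, 'z) addcat_scheme \<Rightarrow> 'o \<Rightarrow> 'o \<Rightarrow> 'm monoid" where
  "HomGroup C X Y = \<lparr>carrier = Hom C X Y, monoid.mult = AddA C, one = ZeroA C X Y\<rparr>"

definition NegA :: "('o, 'm, 'z) addcat_scheme \<Rightarrow> 'm \<Rightarrow> 'm" where
  "NegA C f = inv\<^bsub>HomGroup C (Dom C f) (Cod C f)\<^esub> f"

definition zero_object :: "('o, 'm, 'z) addcat_scheme \<Rightarrow> 'o \<Rightarrow> bool" where
  "zero_object C Z \<longleftrightarrow> Z \<in> Ob C \<and>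
     (\<forall>X \<in> Ob C. Hom C X Z = {ZeroA C X Z} \<and> Hom C Z X = {ZeroA C Z X})"

definition direct_sum :: "('o, 'm, 'z) addcat_scheme \<Rightarrow> 'o \<Rightarrow> 'o \<Rightarrow> 'o \<Rightarrow> bool" where
  "direct_sum C A B P \<longleftrightarrow>
     (\<exists>i \<in> Hom C A P. \<exists>j \<in> Hom C B P. \<exists>p \<in> Hom C P A. \<exists>q \<in> Hom C P B.
        p \<cdot>\<^bsub>C\<^esub> i = Id C A \<and> q \<cdot>\<^bsub>C\<^esub> j = Id C B \<and>
        p \<cdot>\<^bsub>C\<^esub> j = ZeroA C B A \<and> q \<cdot>\<^bsub>C\<^esub> i = ZeroA C A B \<and>
        AddA C (i \<cdot>\<^bsub>C\<^esub> p) (j \<cdot>\<^bsub>C\<^esub> q) = Id C P)"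

locale additive_category = category C
  for C :: "('o, 'm, 'z) addcat_scheme" (structure) +
  assumes Hom_comm_group: "\<lbrakk>X \<in> Ob C; Y \<in> Ob C\<rbrakk> \<Longrightarrow> comm_group (HomGroup C X Y)"
    and Comp_add_left: "\<lbrakk>f \<in> Hom C X Y; g \<in> Hom C Y Z; h \<in> Hom C Y Z\<rbrakk>
      \<Longrightarrow> AddA C g h \<cdot> f = AddA C (g \<cdot> f) (h \<cdot> f)"
    and Comp_add_right: "\<lbrakk>f \<in> Hom C X Y; g \<in> Hom C X Y; h \<in> Hom C Y Z\<rbrakk>
      \<Longrightarrow> h \<cdot> AddA C f g = AddA C (h \<cdot> f) (h \<cdot> g)"
    and zero_object_exists: "\<exists>Z. zero_object C Z"
    and direct_sum_exists: "\<lbrakk>A \<in> Ob C; B \<in> Ob C\<rbrakk> \<Longrightarrow> \<exists>P. direct_sum C A B P"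

section \<open>Triangulated categories\<close>

text \<open>
  \<open>ShO\<close> and \<open>ShA\<close> are the shift functor \<open>[1]\<close> on objects and arrows. It is only required to be
  an additive autoequivalence, which covers the convention that it is an automorphism.
  \<open>Tri\<close> consists of the triples (f, g, h) for which
  \<open>X \<rightarrow>\<^sup>f Y \<rightarrow>\<^sup>g Z \<rightarrow>\<^sup>h X[1]\<close> is distinguished.
\<close>

record ('o, 'm) tricat = "('o, 'm) addcat" +
  ShO :: "'o \<Rightarrow> 'o"
  ShA :: "'m \<Rightarrow> 'm"
  Tri :: "('m \<times> 'm \<times> 'm) set"

definition dist_triangle ::
    "('o, 'm) tricat \<Rightarrow> 'o \<Rightarrow> 'o \<Rightarrow> 'o \<Rightarrow> 'm \<Rightarrow> 'm \<Rightarrow> 'm \<Rightarrow> bool" where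
  "dist_triangle D X Y Z f g h \<longleftrightarrow>
     f \<in> Hom D X Y \<and> g \<in> Hom D Y Z \<and> h \<in> Hom D Z (ShO D X) \<and> (f, g, h) \<in> Tri D"

locale triangulated_category = additive_category D
  for D :: "('o, 'm) tricat" (structure) +
  assumes ShO_in_Ob: "X \<in> Ob D \<Longrightarrow> ShO D X \<in> Ob D"
    and ShA_Id: "X \<in> Ob D \<Longrightarrow> ShA D (Id D X) = Id D (ShO D X)"
    and ShA_Comp: "\<lbrakk>f \<in> Hom D X Y; g \<in> Hom D Y Z\<rbrakk> \<Longrightarrow> ShA D (g \<cdot> f) = ShA D g \<cdot> ShA D f"
    and ShA_add: "\<lbrakk>f \<in> Hom D X Y; g \<in> Hom D X Y\<rbrakk>
      \<Longrightarrow> ShA D (AddA D f g) = AddA D (ShA D f) (ShA D g)"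
    and ShA_bij: "\<lbrakk>X \<in> Ob D; Y \<in> Ob D\<rbrakk>
      \<Longrightarrow> bij_betw (ShA D) (Hom D X Y) (Hom D (ShO D X) (ShO D Y))"
    and ShO_ess_surj: "Y \<in> Ob D \<Longrightarrow> \<exists>X \<in> Ob D. isomorphic D (ShO D X) Y"
    and Tri_triangle: "(f, g, h) \<in> Tri D \<Longrightarrow> \<exists>X Y Z. dist_triangle D X Y Z f g h"
    and TR1_id: "\<lbrakk>X \<in> Ob D; zero_object D Z\<rbrakk>
      \<Longrightarrow> dist_triangle D X X Z (Id D X) (ZeroA D X Z) (ZeroA D Z (ShO D X))"
    and TR1_cone: "f \<in> Hom D X Y \<Longrightarrow> \<exists>Z g h. dist_triangle D X Y Z f g h"
    and TR1_iso: "\<lbrakk>dist_triangle D X Y Z f g h;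
        f' \<in> Hom D X' Y'; g' \<in> Hom D Y' Z'; h' \<in> Hom D Z' (ShO D X');
        is_iso D X X' a; is_iso D Y Y' b; is_iso D Z Z' c;
        b \<cdot> f = f' \<cdot> a; c \<cdot> g = g' \<cdot> b; ShA D a \<cdot> h = h' \<cdot> c\<rbrakk>
      \<Longrightarrow> dist_triangle D X' Y' Z' f' g' h'"
    and TR2: "\<lbrakk>f \<in> Hom D X Y; g \<in> Hom D Y Z; h \<in> Hom D Z (ShO D X)\<rbrakk>
      \<Longrightarrow> dist_triangle D X Y Z f g h \<longleftrightarrow>
          dist_triangle D Y Z (ShO D X) g h (NegA D (ShA D f))"
    and TR3: "\<lbrakk>dist_triangle D X Y Z f g h; dist_triangle D X' Y' Z' f' g' h';
        a \<in> Hom D X X'; b \<in> Hom D Y Y'; b \<cdot> f = f' \<cdot> a\<rbrakk>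
      \<Longrightarrow> \<exists>c \<in> Hom D Z Z'. c \<cdot> g = g' \<cdot> b \<and> ShA D a \<cdot> h = h' \<cdot> c"
    and TR4: "\<lbrakk>dist_triangle D X Y Z' f f1 f2; dist_triangle D Y Z X' g g1 g2;
        dist_triangle D X Z Y' (g \<cdot> f) h1 h2\<rbrakk>
      \<Longrightarrow> \<exists>u v. dist_triangle D Z' Y' X' u v (ShA D f1 \<cdot> g2) \<and>
            u \<cdot> f1 = h1 \<cdot> g \<and> h2 \<cdot> u = f2 \<and> v \<cdot> h1 = g1 \<and> g2 \<cdot> v = ShA D f \<cdot> h2"

section \<open>Subcategories\<close>

text \<open>Full subcategories closed under isomorphisms are represented by their sets of objects.\<close>

definition subcat :: "('o, 'm, 'z) cat_scheme \<Rightarrow> 'o set \<Rightarrow> bool" where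
  "subcat C X \<longleftrightarrow> X \<subseteq> Ob C \<and> (\<forall>A \<in> X. \<forall>B. isomorphic C A B \<longrightarrow> B \<in> X)"

definition hom_zero :: "('o, 'm, 'z) addcat_scheme \<Rightarrow> 'o set \<Rightarrow> 'o set \<Rightarrow> bool" where
  "hom_zero C X Y \<longleftrightarrow> (\<forall>A \<in> X. \<forall>B \<in> Y. Hom C A B = {ZeroA C A B})"

text \<open>
  The subcategory \<open>X[n]\<close>, for an integer n, closed under isomorphisms. As \<open>[1]\<close> is only an
  autoequivalence, no inverse functor is chosen: for \<open>n \<ge> 0\<close> an object A lies in \<open>X[n]\<close> iff
  \<open>A \<cong> B[n]\<close> for some \<open>B \<in> X\<close>, and for \<open>n < 0\<close> iff \<open>A[-n] \<cong> B\<close> for some \<open>B \<in> X\<close>.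
  At least one of the two iterates below is the identity.
\<close>

definition shift_subcat :: "('o, 'm) tricat \<Rightarrow> int \<Rightarrow> 'o set \<Rightarrow> 'o set" where
  "shift_subcat D n X =
     {A \<in> Ob D. \<exists>B \<in> X. isomorphic D ((ShO D ^^ nat (- n)) A) ((ShO D ^^ nat n) B)}"

definition star :: "('o, 'm) tricat \<Rightarrow> 'o set \<Rightarrow> 'o set \<Rightarrow> 'o set" where
  "star D X Y = {A \<in> Ob D. \<exists>B \<in> X. \<exists>C \<in> Y. \<exists>f g h. dist_triangle D B A C f g h}"

section \<open>t-structures and torsion pairs\<close>

text \<open>For \<open>s = (D\<^sup>\<le>\<^sup>0, D\<^sup>\<ge>\<^sup>0)\<close>, the subcategories \<open>D\<^sup>\<le>\<^sup>n\<close> and \<open>D\<^sup>\<ge>\<^sup>n\<close>.\<close>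

definition tle :: "('o, 'm) tricat \<Rightarrow> 'o set \<times> 'o set \<Rightarrow> int \<Rightarrow> 'o set" where
  "tle D s n = shift_subcat D (- n) (fst s)"

definition tge :: "('o, 'm) tricat \<Rightarrow> 'o set \<times> 'o set \<Rightarrow> int \<Rightarrow> 'o set" where
  "tge D s n = shift_subcat D (- n) (snd s)"

definition t_structure :: "('o, 'm) tricat \<Rightarrow> 'o set \<times> 'o set \<Rightarrow> bool" where
  "t_structure D s \<longleftrightarrow> subcat D (fst s) \<and> subcat D (snd s) \<and>
     hom_zero D (fst s) (tge D s 1) \<and>
     Ob D = star D (fst s) (tge D s 1) \<and>
     fst s \<subseteq> tle D s 1 \<and> tge D s 1 \<subseteq> snd s"

text \<open>
  Additive subcategories X of K closed under (finite) direct sums and under direct summands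
  taken in K. Here K is the set of objects of an extension-closed subcategory.
\<close>

definition additive_subcat :: "('o, 'm) tricat \<Rightarrow> 'o set \<Rightarrow> 'o set \<Rightarrow> bool" where
  "additive_subcat D K X \<longleftrightarrow> subcat D X \<and> X \<subseteq> K \<and> (\<exists>Z \<in> X. zero_object D Z) \<and>
     (\<forall>A \<in> X. \<forall>B \<in> X. \<forall>P. direct_sum D A B P \<longrightarrow> P \<in> X) \<and>
     (\<forall>A \<in> K. \<forall>B \<in> K. \<forall>P \<in> X. direct_sum D A B P \<longrightarrow> A \<in> X)"

definition torsion_pair :: "('o, 'm) tricat \<Rightarrow> 'o set \<Rightarrow> 'o set \<times> 'o set \<Rightarrow> bool" where
  "torsion_pair D K t \<longleftrightarrow> additive_subcat D K (fst t) \<and> additive_subcat D K (snd t) \<and>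
     hom_zero D (fst t) (snd t) \<and> K \<subseteq> star D (fst t) (snd t)"

definition s_torsion_pair :: "('o, 'm) tricat \<Rightarrow> 'o set \<Rightarrow> 'o set \<times> 'o set \<Rightarrow> bool" where
  "s_torsion_pair D K t \<longleftrightarrow> torsion_pair D K t \<and>
     hom_zero D (fst t) (shift_subcat D (- 1) (snd t))"

text \<open>On general torsion pairs this relation need not be reflexive.\<close>

definition tors_le :: "('o, 'm) tricat \<Rightarrow> 'o set \<times> 'o set \<Rightarrow> 'o set \<times> 'o set \<Rightarrow> bool" where
  "tors_le D t1 t2 \<longleftrightarrow> hom_zero D (fst t1) (snd t2) \<and>
     hom_zero D (fst t1) (shift_subcat D (- 1) (snd t2))"

definition tors :: "('o, 'm) tricat \<Rightarrow> 'o set \<Rightarrow> ('o set \<times> 'o set) set" where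
  "tors D K = {t. torsion_pair D K t}"

definition s_tors :: "('o, 'm) tricat \<Rightarrow> 'o set \<Rightarrow> ('o set \<times> 'o set) set" where
  "s_tors D K = {t. s_torsion_pair D K t}"

definition interval_heart ::
    "('o, 'm) tricat \<Rightarrow> 'o set \<times> 'o set \<Rightarrow> 'o set \<times> 'o set \<Rightarrow> 'o set" where
  "interval_heart D s1 s2 = fst s2 \<inter> tge D s1 1"

definition tors_interval ::
    "('o, 'm) tricat \<Rightarrow> 'o set \<times> 'o set \<Rightarrow> 'o set \<times> 'o set \<Rightarrow> ('o set \<times> 'o set) set" where
  "tors_interval D s1 s2 = {t \<in> tors D (Ob D).
     tors_le D (fst s1, tge D s1 1) t \<and> tors_le D t (fst s2, tge D s2 1)}"

definition t_str_interval ::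
    "('o, 'm) tricat \<Rightarrow> 'o set \<times> 'o set \<Rightarrow> 'o set \<times> 'o set \<Rightarrow> ('o set \<times> 'o set) set" where
  "t_str_interval D s1 s2 = {s. t_structure D s \<and> fst s1 \<subseteq> fst s \<and> fst s \<subseteq> fst s2}"

definition t_str_le :: "'o set \<times> 'o set \<Rightarrow> 'o set \<times> 'o set \<Rightarrow> bool" where
  "t_str_le s s' \<longleftrightarrow> fst s \<subseteq> fst s'"

definition inverse_order_bijections ::
    "'a set \<Rightarrow> ('a \<Rightarrow> 'a \<Rightarrow> bool) \<Rightarrow> 'b set \<Rightarrow> ('b \<Rightarrow> 'b \<Rightarrow> bool) \<Rightarrow> ('a \<Rightarrow> 'b) \<Rightarrow> ('b \<Rightarrow> 'a) \<Rightarrow> bool"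
  where
  "inverse_order_bijections A leA B leB \<phi> \<psi> \<longleftrightarrow>
     bij_betw \<phi> A B \<and> bij_betw \<psi> B A \<and>
     (\<forall>a \<in> A. \<psi> (\<phi> a) = a) \<and> (\<forall>b \<in> B. \<phi> (\<psi> b) = b) \<and>
     monotone_on A leA leB \<phi> \<and> monotone_on B leB leA \<psi>"

end

theory Submission
  imports Defs
begin

text \<open>
  Every pair in the theorem is determined by orthogonality. Write \<open>A\<^sub>i\<close> for the aisle of \<open>s\<^sub>i\<close>,
  \<open>B\<^sub>i\<close> for \<open>C\<^sub>i\<^sup>\<ge>\<^sup>1\<close> and \<open>H\<close> for the intersection of \<open>A\<^sub>2\<close> and \<open>B\<^sub>1\<close>. If K is closed under
  summands, a torsion pair (T, F) in K consists of the left orthogonal of F and the right orthogonal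
  of T, both taken in K (\<open>torsion_pair_iff\<close>): when the map from X to F in a decomposition triangle
  \<open>T \<rightarrow> X \<rightarrow> F\<close> vanishes, X is a summand of T, and dually. A t-structure s is the same as a torsion
  pair \<open>(D\<^sup>\<le>\<^sup>0, D\<^sup>\<ge>\<^sup>1)\<close> of D whose first class is closed under [1]
  (\<open>t_structure_iff_aisle_pair\<close>).

  The key computation is that for a torsion pair (T, F) in H the class \<open>A\<^sub>1 * T\<close> is the left
  orthogonal of F and \<open>B\<^sub>2\<close>, and \<open>F * B\<^sub>2\<close> is the right orthogonal of \<open>A\<^sub>1\<close> and T
  (\<open>star_eq_lperp\<close>, \<open>star_eq_rperp\<close>). For instance, an object X with no maps to F and \<open>B\<^sub>2\<close>
  lies in \<open>A\<^sub>2\<close>; its \<open>B\<^sub>1\<close>-part is then in H, and it still has no maps to F, since neither X nor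
  \<open>A\<^sub>1[1]\<close> has any; so it lies in T. This makes \<open>\<psi>(T, F)\<close> a pair of mutually orthogonal classes. That they decompose
  every object comes from two uses of the octahedral axiom (\<open>star_decomposition\<close>): filter X by its
  \<open>A\<^sub>1\<close>-part, a T-part, an F-part and its \<open>B\<^sub>2\<close>-part, and cut the filtration in the middle.

  For a torsion pair (U, V) of D with \<open>A\<^sub>1 \<subseteq> U \<subseteq> A\<^sub>2\<close>, the decomposition triangle of an object of H
  stays inside H (\<open>phi_torsion_pair\<close>), so \<open>\<phi>\<close> is well defined. That \<open>\<phi>\<close> and \<open>\<psi>\<close> are mutually
  inverse is read off from the orthogonality descriptions together with closure under extensions.

  For t-structures, \<open>\<psi>(T, F)\<close> has its first class closed under [1] exactly because
  \<open>D(T[1], F) = 0\<close>, which is the condition defining s-torsion pairs. The second component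
  \<open>F[1] * C\<^sub>2\<^sup>\<ge>\<^sup>0\<close> is \<open>F * B\<^sub>2\<close> shifted by one (\<open>tge_psi\<close>), and a coaisle is determined by its shift
  (\<open>coaisle_eqI\<close>); so the second bijection is a restriction of the first.
\<close>

section \<open>Arrows in additive categories\<close>

context additive_category
begin

lemma Hom_objects:
  assumes "f \<in> Hom C X Y" shows "X \<in> Ob C" "Y \<in> Ob C"
  using assms Dom_in_Ob Cod_in_Ob unfolding Hom_def by auto

lemma Hom_group: "\<lbrakk>X \<in> Ob C; Y \<in> Ob C\<rbrakk> \<Longrightarrow> group (HomGroup C X Y)"
  using Hom_comm_group comm_group.axioms(2) by blast

lemma HomGroup_simps:
  "carrier (HomGroup C X Y) = Hom C X Y"
  "f \<otimes>\<^bsub>HomGroup C X Y\<^esub> g = AddA C f g"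
  "\<one>\<^bsub>HomGroup C X Y\<^esub> = ZeroA C X Y"
  by (simp_all add: HomGroup_def)

lemma Zero_in_Hom: "\<lbrakk>X \<in> Ob C; Y \<in> Ob C\<rbrakk> \<Longrightarrow> ZeroA C X Y \<in> Hom C X Y"
  using monoid.one_closed[OF group.is_monoid[OF Hom_group]] by (simp add: HomGroup_simps)

lemma Add_in_Hom: "\<lbrakk>f \<in> Hom C X Y; g \<in> Hom C X Y\<rbrakk> \<Longrightarrow> AddA C f g \<in> Hom C X Y"
  using monoid.m_closed[OF group.is_monoid[OF Hom_group], of X Y f g] Hom_objects
  by (simp add: HomGroup_simps)

lemma Neg_in_Hom: "f \<in> Hom C X Y \<Longrightarrow> NegA C f \<in> Hom C X Y"
  using group.inv_closed[OF Hom_group, of X Y f] Hom_objects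
  by (simp add: HomGroup_simps NegA_def) (simp add: Hom_def)

lemma Neg_add: "f \<in> Hom C X Y \<Longrightarrow> AddA C (NegA C f) f = ZeroA C X Y"
  using group.l_inv[OF Hom_group, of X Y f] Hom_objects
  by (simp add: HomGroup_simps NegA_def) (simp add: Hom_def)

lemma add_Neg: "f \<in> Hom C X Y \<Longrightarrow> AddA C f (NegA C f) = ZeroA C X Y"
  using group.r_inv[OF Hom_group, of X Y f] Hom_objects
  by (simp add: HomGroup_simps NegA_def) (simp add: Hom_def)

lemma Add_Zero_right: "f \<in> Hom C X Y \<Longrightarrow> AddA C f (ZeroA C X Y) = f"
  using monoid.r_one[OF group.is_monoid[OF Hom_group], of X Y f] Hom_objects
  by (simp add: HomGroup_simps)

lemma Add_Zero_left: "f \<in> Hom C X Y \<Longrightarrow> AddA C (ZeroA C X Y) f = f"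
  using monoid.l_one[OF group.is_monoid[OF Hom_group], of X Y f] Hom_objects
  by (simp add: HomGroup_simps)

lemma Add_assoc:
  "\<lbrakk>f \<in> Hom C X Y; g \<in> Hom C X Y; h \<in> Hom C X Y\<rbrakk>
    \<Longrightarrow> AddA C (AddA C f g) h = AddA C f (AddA C g h)"
  using monoid.m_assoc[OF group.is_monoid[OF Hom_group], of X Y f g h] Hom_objects
  by (simp add: HomGroup_simps)

lemma Add_idem_Zero: "\<lbrakk>f \<in> Hom C X Y; AddA C f f = f\<rbrakk> \<Longrightarrow> f = ZeroA C X Y"
  using group.l_cancel_one[OF Hom_group, of X Y f f] Hom_objects
  by (simp add: HomGroup_simps)

lemma Neg_unique:
  assumes "f \<in> Hom C X Y" "g \<in> Hom C X Y" "AddA C g f = ZeroA C X Y"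
  shows "g = NegA C f"
  using group.inv_equality[OF Hom_group, of X Y g f] assms Hom_objects
  by (simp add: HomGroup_simps NegA_def) (simp add: Hom_def)

lemma Neg_Neg: "f \<in> Hom C X Y \<Longrightarrow> NegA C (NegA C f) = f"
  using Neg_unique[of "NegA C f" X Y f] Neg_in_Hom add_Neg by metis

lemma Neg_inject:
  "\<lbrakk>f \<in> Hom C X Y; g \<in> Hom C X Y; NegA C f = NegA C g\<rbrakk> \<Longrightarrow> f = g"
  using Neg_Neg by metis

lemma Comp_Zero_right:
  assumes "W \<in> Ob C" "g \<in> Hom C X Y" shows "g \<cdot> ZeroA C W X = ZeroA C W Y"
proof -
  have z: "ZeroA C W X \<in> Hom C W X" using assms Hom_objects Zero_in_Hom by blast
  show ?thesis
    using Add_idem_Zero[OF Comp_in_Hom[OF z assms(2)]] Comp_add_right[OF z z assms(2)]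
      Add_Zero_right[OF z] by simp
qed

lemma Comp_Zero_left:
  assumes "W \<in> Ob C" "g \<in> Hom C X Y" shows "ZeroA C Y W \<cdot> g = ZeroA C X W"
proof -
  have z: "ZeroA C Y W \<in> Hom C Y W" using assms Hom_objects Zero_in_Hom by blast
  show ?thesis
    using Add_idem_Zero[OF Comp_in_Hom[OF assms(2) z]] Comp_add_left[OF assms(2) z z]
      Add_Zero_right[OF z] by simp
qed

lemma Comp_Neg_left:
  assumes "f \<in> Hom C X Y" "g \<in> Hom C Y Z" shows "NegA C g \<cdot> f = NegA C (g \<cdot> f)"
  using Neg_unique[OF Comp_in_Hom[OF assms] Comp_in_Hom[OF assms(1) Neg_in_Hom[OF assms(2)]]]
    Comp_add_left[OF assms(1) Neg_in_Hom[OF assms(2)] assms(2)] Neg_add[OF assms(2)]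
    Comp_Zero_left[OF Hom_objects(2)[OF assms(2)] assms(1)] by simp

lemma Comp_Neg_right:
  assumes "f \<in> Hom C X Y" "g \<in> Hom C Y Z" shows "g \<cdot> NegA C f = NegA C (g \<cdot> f)"
  using Neg_unique[OF Comp_in_Hom[OF assms] Comp_in_Hom[OF Neg_in_Hom[OF assms(1)] assms(2)]]
    Comp_add_right[OF Neg_in_Hom[OF assms(1)] assms(1) assms(2)] Neg_add[OF assms(1)]
    Comp_Zero_right[OF Hom_objects(1)[OF assms(1)] assms(2)] by simp

lemma is_iso_Id: "X \<in> Ob C \<Longrightarrow> is_iso C X X (Id C X)"
  unfolding is_iso_def using Id_in_Hom Comp_Id_left by blast

lemma isomorphic_sym: "isomorphic C X Y \<Longrightarrow> isomorphic C Y X"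
  unfolding isomorphic_def is_iso_def by blast

lemma isomorphic_Ob: "isomorphic C X Y \<Longrightarrow> X \<in> Ob C \<and> Y \<in> Ob C"
  unfolding isomorphic_def is_iso_def using Hom_objects by blast

lemma isomorphic_refl: "X \<in> Ob C \<Longrightarrow> isomorphic C X X"
  unfolding isomorphic_def using is_iso_Id by blast

lemma zero_object_Hom:
  assumes "zero_object C Z" "X \<in> Ob C"
  shows "f \<in> Hom C X Z \<Longrightarrow> f = ZeroA C X Z" "f \<in> Hom C Z X \<Longrightarrow> f = ZeroA C Z X"
  using assms by (auto simp: zero_object_def)

lemma zero_object_if_Id_Zero:
  assumes "Z \<in> Ob C" "Id C Z = ZeroA C Z Z" shows "zero_object C Z"
  unfolding zero_object_def
proof (intro conjI ballI)
  show "Z \<in> Ob C" by fact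
next
  fix X assume X: "X \<in> Ob C"
  have "f = ZeroA C X Z" if "f \<in> Hom C X Z" for f
    using Comp_Id_left[OF that] assms Comp_Zero_left[OF assms(1) that] by simp
  then show "Hom C X Z = {ZeroA C X Z}" using Zero_in_Hom[OF X assms(1)] by blast
  have "f = ZeroA C Z X" if "f \<in> Hom C Z X" for f
    using Comp_Id_right[OF that] assms Comp_Zero_right[OF assms(1) that] by simp
  then show "Hom C Z X = {ZeroA C Z X}" using Zero_in_Hom[OF assms(1) X] by blast
qed

section \<open>Orthogonality\<close>

definition orth :: "'o \<Rightarrow> 'o \<Rightarrow> bool" where
  "orth A B \<longleftrightarrow> Hom C A B = {ZeroA C A B}"

text \<open>
  Retracts are used instead of summands because they pass directly through orthogonality; in a
  triangulated category the two notions agree, by \<open>retract_direct_sum\<close> below.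
\<close>

definition retract :: "'o \<Rightarrow> 'o \<Rightarrow> bool" where
  "retract A P \<longleftrightarrow> (\<exists>i \<in> Hom C A P. \<exists>p \<in> Hom C P A. p \<cdot> i = Id C A)"

definition lperp :: "'o set \<Rightarrow> 'o set" where
  "lperp Y = {A \<in> Ob C. \<forall>B \<in> Y. orth A B}"

definition rperp :: "'o set \<Rightarrow> 'o set" where
  "rperp X = {B \<in> Ob C. \<forall>A \<in> X. orth A B}"

text \<open>
  The closure properties shared by the ambient category, the classes \<open>lperp\<close> and \<open>rperp\<close>, and
  therefore interval hearts.
\<close>

definition summand_closed :: "'o set \<Rightarrow> bool" where
  "summand_closed K \<longleftrightarrow> K \<subseteq> Ob C \<and> (\<forall>Z. zero_object C Z \<longrightarrow> Z \<in> K) \<and>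
     (\<forall>A \<in> K. \<forall>B \<in> K. \<forall>P. direct_sum C A B P \<longrightarrow> P \<in> K) \<and>
     (\<forall>P \<in> K. \<forall>A. retract A P \<longrightarrow> A \<in> K)"

lemma hom_zero_iff_orth: "hom_zero C X Y \<longleftrightarrow> (\<forall>A \<in> X. \<forall>B \<in> Y. orth A B)"
  by (simp add: hom_zero_def orth_def)

lemma orthI:
  "\<lbrakk>A \<in> Ob C; B \<in> Ob C; \<And>f. f \<in> Hom C A B \<Longrightarrow> f = ZeroA C A B\<rbrakk> \<Longrightarrow> orth A B"
  unfolding orth_def using Zero_in_Hom by blast

lemma orthD: "\<lbrakk>orth A B; f \<in> Hom C A B\<rbrakk> \<Longrightarrow> f = ZeroA C A B"
  unfolding orth_def by blast

lemma orth_Ob: "orth A B \<Longrightarrow> A \<in> Ob C \<and> B \<in> Ob C"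
  unfolding orth_def using Hom_objects by blast

lemma isomorphic_retract: "isomorphic C A B \<Longrightarrow> retract A B"
  unfolding isomorphic_def is_iso_def retract_def by blast

lemma orth_retract_left:
  assumes "retract A P" "orth P B" shows "orth A B"
proof -
  obtain i p where ip: "i \<in> Hom C A P" "p \<in> Hom C P A" "p \<cdot> i = Id C A"
    using assms unfolding retract_def by blast
  show ?thesis
  proof (rule orthI)
    show "A \<in> Ob C" "B \<in> Ob C" using ip Hom_objects assms orth_Ob by blast+
    fix f assume f: "f \<in> Hom C A B"
    have "f = f \<cdot> (p \<cdot> i)" using ip(3) Comp_Id_right[OF f] by simp
    also have "\<dots> = (f \<cdot> p) \<cdot> i" using Comp_assoc[OF ip(1,2) f] by simp
    also have "f \<cdot> p = ZeroA C P B" using orthD[OF assms(2) Comp_in_Hom[OF ip(2) f]] .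
    finally show "f = ZeroA C A B"
      using Comp_Zero_left[OF Hom_objects(2)[OF f] ip(1)] by simp
  qed
qed

lemma orth_retract_right:
  assumes "retract B P" "orth A P" shows "orth A B"
proof -
  obtain i p where ip: "i \<in> Hom C B P" "p \<in> Hom C P B" "p \<cdot> i = Id C B"
    using assms unfolding retract_def by blast
  show ?thesis
  proof (rule orthI)
    show "A \<in> Ob C" "B \<in> Ob C" using ip Hom_objects assms orth_Ob by blast+
    fix f assume f: "f \<in> Hom C A B"
    have "f = (p \<cdot> i) \<cdot> f" using ip(3) Comp_Id_left[OF f] by simp
    also have "\<dots> = p \<cdot> (i \<cdot> f)" using Comp_assoc[OF f ip(1,2)] by simp
    also have "i \<cdot> f = ZeroA C A P" using orthD[OF assms(2) Comp_in_Hom[OF f ip(1)]] .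
    finally show "f = ZeroA C A B"
      using Comp_Zero_right[OF Hom_objects(1)[OF f] ip(2)] by simp
  qed
qed

lemma direct_sum_retracts:
  assumes "direct_sum C A B P" shows "retract A P" "retract B P"
  using assms unfolding direct_sum_def retract_def by blast+

lemma orth_direct_sum_left:
  assumes "direct_sum C A B P" "orth A X" "orth B X" shows "orth P X"
proof -
  obtain i j p q where h: "i \<in> Hom C A P" "j \<in> Hom C B P" "p \<in> Hom C P A" "q \<in> Hom C P B"
    "AddA C (i \<cdot> p) (j \<cdot> q) = Id C P"
    using assms unfolding direct_sum_def by blast
  show ?thesis
  proof (rule orthI)
    show P: "P \<in> Ob C" and X: "X \<in> Ob C" using h Hom_objects assms orth_Ob by blast+
    fix f assume f: "f \<in> Hom C P X"
    have "f = f \<cdot> AddA C (i \<cdot> p) (j \<cdot> q)" using h Comp_Id_right[OF f] by simp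
    also have "\<dots> = AddA C (f \<cdot> (i \<cdot> p)) (f \<cdot> (j \<cdot> q))"
      using Comp_add_right[OF Comp_in_Hom[OF h(3,1)] Comp_in_Hom[OF h(4,2)] f] .
    also have "\<dots> = AddA C ((f \<cdot> i) \<cdot> p) ((f \<cdot> j) \<cdot> q)"
      using Comp_assoc[OF h(3,1) f] Comp_assoc[OF h(4,2) f] by simp
    also have "\<dots> = AddA C (ZeroA C P X) (ZeroA C P X)"
      using orthD[OF assms(2) Comp_in_Hom[OF h(1) f]] orthD[OF assms(3) Comp_in_Hom[OF h(2) f]]
        Comp_Zero_left[OF X h(3)] Comp_Zero_left[OF X h(4)] by simp
    finally show "f = ZeroA C P X" using Add_Zero_left Zero_in_Hom[OF P X] by simp
  qed
qed

lemma orth_direct_sum_right: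
  assumes "direct_sum C A B P" "orth X A" "orth X B" shows "orth X P"
proof -
  obtain i j p q where h: "i \<in> Hom C A P" "j \<in> Hom C B P" "p \<in> Hom C P A" "q \<in> Hom C P B"
    "AddA C (i \<cdot> p) (j \<cdot> q) = Id C P"
    using assms unfolding direct_sum_def by blast
  show ?thesis
  proof (rule orthI)
    show P: "P \<in> Ob C" and X: "X \<in> Ob C" using h Hom_objects assms orth_Ob by blast+
    fix f assume f: "f \<in> Hom C X P"
    have "f = AddA C (i \<cdot> p) (j \<cdot> q) \<cdot> f" using h Comp_Id_left[OF f] by simp
    also have "\<dots> = AddA C ((i \<cdot> p) \<cdot> f) ((j \<cdot> q) \<cdot> f)"
      using Comp_add_left[OF f Comp_in_Hom[OF h(3,1)] Comp_in_Hom[OF h(4,2)]] .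
    also have "\<dots> = AddA C (i \<cdot> (p \<cdot> f)) (j \<cdot> (q \<cdot> f))"
      using Comp_assoc[OF f h(3,1)] Comp_assoc[OF f h(4,2)] by simp
    also have "\<dots> = AddA C (ZeroA C X P) (ZeroA C X P)"
      using orthD[OF assms(2) Comp_in_Hom[OF f h(3)]] orthD[OF assms(3) Comp_in_Hom[OF f h(4)]]
        Comp_Zero_right[OF X h(1)] Comp_Zero_right[OF X h(2)] by simp
    finally show "f = ZeroA C X P" using Add_Zero_left Zero_in_Hom[OF X P] by simp
  qed
qed

lemma summand_closed_lperp:
  assumes "Y \<subseteq> Ob C" shows "summand_closed (lperp Y)"
  unfolding summand_closed_def
proof (intro conjI allI ballI impI)
  show "lperp Y \<subseteq> Ob C" by (auto simp: lperp_def)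
  show "Z \<in> lperp Y" if "zero_object C Z" for Z
    using that assms unfolding zero_object_def lperp_def orth_def by auto
  show "P \<in> lperp Y" if "A \<in> lperp Y" "B \<in> lperp Y" "direct_sum C A B P" for A B P
  proof -
    have "P \<in> Ob C" using that(3) Hom_objects unfolding direct_sum_def by blast
    then show ?thesis using that orth_direct_sum_left unfolding lperp_def by blast
  qed
  show "A \<in> lperp Y" if "P \<in> lperp Y" "retract A P" for A P
  proof -
    have "A \<in> Ob C" using that(2) Hom_objects unfolding retract_def by blast
    then show ?thesis using that orth_retract_left unfolding lperp_def by blast
  qed
qed

lemma summand_closed_rperp:
  assumes "Y \<subseteq> Ob C" shows "summand_closed (rperp Y)"
  unfolding summand_closed_def
proof (intro conjI allI ballI impI)
  show "rperp Y \<subseteq> Ob C" by (auto simp: rperp_def)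
  show "Z \<in> rperp Y" if "zero_object C Z" for Z
    using that assms unfolding zero_object_def rperp_def orth_def by auto
  show "P \<in> rperp Y" if "A \<in> rperp Y" "B \<in> rperp Y" "direct_sum C A B P" for A B P
  proof -
    have "P \<in> Ob C" using that(3) Hom_objects unfolding direct_sum_def by blast
    then show ?thesis using that orth_direct_sum_right unfolding rperp_def by blast
  qed
  show "A \<in> rperp Y" if "P \<in> rperp Y" "retract A P" for A P
  proof -
    have "A \<in> Ob C" using that(2) Hom_objects unfolding retract_def by blast
    then show ?thesis using that orth_retract_right unfolding rperp_def by blast
  qed
qed

lemma summand_closed_Int: "\<lbrakk>summand_closed K; summand_closed L\<rbrakk> \<Longrightarrow> summand_closed (K \<inter> L)"
  unfolding summand_closed_def by blast

lemma summand_closed_Ob: "summand_closed (Ob C)"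
proof -
  have "Ob C = lperp {}" by (simp add: lperp_def)
  then show ?thesis using summand_closed_lperp[of "{}"] by simp
qed

lemma summand_closed_subcat: "summand_closed K \<Longrightarrow> subcat C K"
  unfolding summand_closed_def subcat_def
  using isomorphic_retract isomorphic_sym by blast

lemma subcat_iso: "\<lbrakk>subcat C K; A \<in> K; isomorphic C A B\<rbrakk> \<Longrightarrow> B \<in> K"
  unfolding subcat_def by blast

end

section \<open>Exactness in triangulated categories\<close>

context triangulated_category
begin

lemma ShA_in_Hom: "f \<in> Hom D X Y \<Longrightarrow> ShA D f \<in> Hom D (ShO D X) (ShO D Y)"
  using ShA_bij[of X Y] Hom_objects unfolding bij_betw_def by blast

lemma ShA_inject: "\<lbrakk>f \<in> Hom D X Y; g \<in> Hom D X Y; ShA D f = ShA D g\<rbrakk> \<Longrightarrow> f = g"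
  using ShA_bij[of X Y] Hom_objects unfolding bij_betw_def inj_on_def by blast

lemma ShA_full:
  assumes "X \<in> Ob D" "Y \<in> Ob D" "g \<in> Hom D (ShO D X) (ShO D Y)"
  obtains f where "f \<in> Hom D X Y" "ShA D f = g"
proof -
  have "g \<in> ShA D ` Hom D X Y"
    using bij_betw_imp_surj_on[OF ShA_bij[OF assms(1,2)]] assms(3) by simp
  then show ?thesis using that by blast
qed

lemma ShA_Zero:
  assumes "X \<in> Ob D" "Y \<in> Ob D" shows "ShA D (ZeroA D X Y) = ZeroA D (ShO D X) (ShO D Y)"
proof -
  have z: "ZeroA D X Y \<in> Hom D X Y" using assms Zero_in_Hom by blast
  show ?thesis
    using Add_idem_Zero[OF ShA_in_Hom[OF z]] ShA_add[OF z z] Add_Zero_right[OF z] by simp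
qed

lemma orth_ShO:
  assumes "X \<in> Ob D" "Y \<in> Ob D" shows "orth (ShO D X) (ShO D Y) \<longleftrightarrow> orth X Y"
proof
  assume o: "orth (ShO D X) (ShO D Y)"
  show "orth X Y"
  proof (rule orthI[OF assms])
    fix f assume f: "f \<in> Hom D X Y"
    have "ShA D f = ShA D (ZeroA D X Y)"
      using orthD[OF o ShA_in_Hom[OF f]] ShA_Zero[OF assms] by simp
    then show "f = ZeroA D X Y" using ShA_inject[OF f Zero_in_Hom[OF assms]] by blast
  qed
next
  assume o: "orth X Y"
  show "orth (ShO D X) (ShO D Y)"
  proof (rule orthI)
    show "ShO D X \<in> Ob D" "ShO D Y \<in> Ob D" using ShO_in_Ob assms by blast+
    fix g assume "g \<in> Hom D (ShO D X) (ShO D Y)"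
    then obtain f where "f \<in> Hom D X Y" "ShA D f = g" using ShA_full assms by blast
    then show "g = ZeroA D (ShO D X) (ShO D Y)" using orthD[OF o] ShA_Zero[OF assms] by metis
  qed
qed

lemma zero_object_ShO:
  assumes "zero_object D Z" shows "zero_object D (ShO D Z)"
proof (rule zero_object_if_Id_Zero)
  have Z: "Z \<in> Ob D" using assms by (simp add: zero_object_def)
  then show "ShO D Z \<in> Ob D" by (rule ShO_in_Ob)
  have "Id D Z = ZeroA D Z Z" using zero_object_Hom(1)[OF assms Z Id_in_Hom[OF Z]] .
  then show "Id D (ShO D Z) = ZeroA D (ShO D Z) (ShO D Z)"
    using ShA_Id[OF Z] ShA_Zero[OF Z Z] by simp
qed

lemma triangle_Hom:
  assumes "dist_triangle D X Y Z f g h"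
  shows "f \<in> Hom D X Y" "g \<in> Hom D Y Z" "h \<in> Hom D Z (ShO D X)"
  using assms by (simp_all add: dist_triangle_def)

lemma triangle_Ob:
  assumes "dist_triangle D X Y Z f g h"
  shows "X \<in> Ob D" "Y \<in> Ob D" "Z \<in> Ob D"
  using triangle_Hom[OF assms] Hom_objects by blast+

lemma triangle_rotate:
  assumes t: "dist_triangle D X Y Z f g h"
  shows "dist_triangle D Y Z (ShO D X) g h (NegA D (ShA D f))"
  using TR2[OF triangle_Hom[OF t]] t by simp

text \<open>
  The triangle is compared by TR3 with \<open>0 \<rightarrow> W \<rightarrow> W \<rightarrow> 0[1]\<close>, whose third object is W; the arrow
  that TR3 produces on third objects is the factorisation.
\<close>

lemma triangle_weak_cokernel:
  assumes t: "dist_triangle D X Y Z f g h" and u: "u \<in> Hom D Y W" "u \<cdot> f = ZeroA D X W"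
  obtains w where "w \<in> Hom D Z W" "w \<cdot> g = u"
proof -
  obtain N where N: "zero_object D N" using zero_object_exists by blast
  have NO: "N \<in> Ob D" using N by (simp add: zero_object_def)
  have WO: "W \<in> Ob D" using u Hom_objects by blast
  have SN: "zero_object D (ShO D N)" using zero_object_ShO[OF N] .
  have SO: "ShO D N \<in> Ob D" using ShO_in_Ob[OF NO] .
  let ?z = "ZeroA D N W"
  have z: "?z \<in> Hom D N W" using Zero_in_Hom NO WO by blast
  have "NegA D (ShA D ?z) = ZeroA D (ShO D N) (ShO D W)"
    using zero_object_Hom(2)[OF SN ShO_in_Ob[OF WO] Neg_in_Hom[OF ShA_in_Hom[OF z]]] .
  then have "dist_triangle D N W W ?z (Id D W) (ZeroA D W (ShO D N))"
    using TR2[OF z Id_in_Hom[OF WO] Zero_in_Hom[OF WO SO]] TR1_id[OF WO SN] by simp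
  from TR3[OF t this Zero_in_Hom[OF triangle_Ob(1)[OF t] NO] u(1)]
  obtain c where "c \<in> Hom D Z W" "c \<cdot> g = Id D W \<cdot> u"
    using u(2) Comp_Zero_right[OF triangle_Ob(1)[OF t] z] by auto
  then show ?thesis using that Comp_Id_left[OF u(1)] by simp
qed

text \<open>
  TR3 only completes a morphism at the third object. Both triangles are therefore rotated once,
  which puts the wanted arrow, shifted by one, in the third place; full faithfulness of the shift
  brings it back, and the signs introduced by the rotations cancel.
\<close>

lemma triangle_weak_kernel:
  assumes t: "dist_triangle D X Y Z f g h" and u: "u \<in> Hom D W Y" "g \<cdot> u = ZeroA D W Z"
  obtains w where "w \<in> Hom D W X" "f \<cdot> w = u"
proof -
  obtain N where N: "zero_object D N" using zero_object_exists by blast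
  have NO: "N \<in> Ob D" using N by (simp add: zero_object_def)
  have WO: "W \<in> Ob D" using u Hom_objects by blast
  have XO: "X \<in> Ob D" using triangle_Ob[OF t] by blast
  have ZO: "Z \<in> Ob D" using triangle_Ob[OF t] by blast
  have s: "dist_triangle D W N (ShO D W) (ZeroA D W N) (ZeroA D N (ShO D W))
      (NegA D (Id D (ShO D W)))"
    using triangle_rotate[OF TR1_id[OF WO N]] ShA_Id[OF WO] by simp
  have "ZeroA D N Z \<cdot> ZeroA D W N = g \<cdot> u"
    using u(2) Comp_Zero_left[OF ZO Zero_in_Hom[OF WO NO]] by simp
  from TR3[OF s triangle_rotate[OF t] u(1) Zero_in_Hom[OF NO ZO] this]
  obtain c where c: "c \<in> Hom D (ShO D W) (ShO D X)"
    "ShA D u \<cdot> NegA D (Id D (ShO D W)) = NegA D (ShA D f) \<cdot> c" by blast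
  obtain w where w: "w \<in> Hom D W X" "ShA D w = c" using ShA_full[OF WO XO c(1)] .
  note f = triangle_Hom(1)[OF t]
  have su: "ShA D u \<in> Hom D (ShO D W) (ShO D Y)" using ShA_in_Hom[OF u(1)] .
  have "NegA D (ShA D u) = NegA D (ShA D f \<cdot> c)"
    using c(2) Comp_Neg_right[OF Id_in_Hom[OF ShO_in_Ob[OF WO]] su] Comp_Id_right[OF su]
      Comp_Neg_left[OF c(1) ShA_in_Hom[OF f]] by simp
  then have "ShA D u = ShA D f \<cdot> c"
    using Neg_inject[OF su Comp_in_Hom[OF c(1) ShA_in_Hom[OF f]]] by blast
  then have "ShA D u = ShA D (f \<cdot> w)" using ShA_Comp[OF w(1) f] w(2) by simp
  then have "u = f \<cdot> w" using ShA_inject[OF u(1) Comp_in_Hom[OF w(1) f]] by blast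
  then show ?thesis using that w by blast
qed

text \<open>
  TR3 applied to a morphism from \<open>X \<rightarrow> X \<rightarrow> 0\<close> shows that \<open>g \<cdot> f\<close> factors through a zero object.
\<close>

lemma triangle_Comp_Zero:
  assumes t: "dist_triangle D X Y Z f g h" shows "g \<cdot> f = ZeroA D X Z"
proof -
  obtain N where N: "zero_object D N" using zero_object_exists by blast
  have X: "X \<in> Ob D" using triangle_Ob[OF t] by blast
  note f = triangle_Hom(1)[OF t]
  from TR3[OF TR1_id[OF X N] t Id_in_Hom[OF X] f]
  obtain c where "c \<in> Hom D N Z" "c \<cdot> ZeroA D X N = g \<cdot> f" by blast
  then show ?thesis using Comp_Zero_right[OF X] by metis
qed

text \<open>
  The obstruction to f being monic is the image of the connecting arrow: if \<open>f \<cdot> d\<close> vanishes,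
  then \<open>d[1]\<close> factors through h.
\<close>

lemma triangle_monic:
  assumes t: "dist_triangle D X Y Z f g h" and h: "h = ZeroA D Z (ShO D X)"
    and x: "x \<in> Hom D W X" "y \<in> Hom D W X" "f \<cdot> x = f \<cdot> y"
  shows "x = y"
proof -
  note f = triangle_Hom(1)[OF t]
  have W: "W \<in> Ob D" and X: "X \<in> Ob D" using Hom_objects x by blast+
  let ?d = "AddA D (NegA D y) x"
  have d: "?d \<in> Hom D W X" using x Add_in_Hom Neg_in_Hom by blast
  have sd: "ShA D ?d \<in> Hom D (ShO D W) (ShO D X)" using ShA_in_Hom[OF d] .
  have "f \<cdot> ?d = ZeroA D W Y"
    using Comp_add_right[OF Neg_in_Hom[OF x(2)] x(1) f] Comp_Neg_right[OF x(2) f] x(3)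
      Neg_add[OF Comp_in_Hom[OF x(2) f]] by simp
  then have "ShA D f \<cdot> ShA D ?d = ZeroA D (ShO D W) (ShO D Y)"
    using ShA_Comp[OF d f] ShA_Zero[OF W Hom_objects(2)[OF f]] by simp
  moreover have "NegA D (ZeroA D (ShO D W) (ShO D Y)) = ZeroA D (ShO D W) (ShO D Y)"
    using Neg_unique Add_Zero_left Zero_in_Hom ShO_in_Ob W Hom_objects(2)[OF f] by metis
  ultimately have "NegA D (ShA D f) \<cdot> ShA D ?d = ZeroA D (ShO D W) (ShO D Y)"
    using Comp_Neg_left[OF sd ShA_in_Hom[OF f]] by simp
  then obtain w where w: "w \<in> Hom D (ShO D W) Z" "h \<cdot> w = ShA D ?d"
    using triangle_weak_kernel[OF triangle_rotate[OF triangle_rotate[OF t]] sd] by blast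
  then have "ShA D ?d = ZeroA D (ShO D W) (ShO D X)"
    using h Comp_Zero_left[OF ShO_in_Ob[OF X] w(1)] by simp
  then have "?d = ZeroA D W X"
    using ShA_inject[OF d Zero_in_Hom[OF W X]] ShA_Zero[OF W X] by simp
  then have "NegA D y = NegA D x" using Neg_unique[OF x(1) Neg_in_Hom[OF x(2)]] by blast
  then show ?thesis using Neg_inject[OF x(1,2)] by simp
qed

lemma triangle_retract_left:
  assumes t: "dist_triangle D X Y Z f g h" and g: "g = ZeroA D Y Z"
  shows "\<exists>s \<in> Hom D Y X. f \<cdot> s = Id D Y"
proof -
  have Y: "Y \<in> Ob D" using triangle_Ob[OF t] by blast
  have "g \<cdot> Id D Y = ZeroA D Y Z" using g Comp_Id_right[OF triangle_Hom(2)[OF t]] by simp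
  then show ?thesis using triangle_weak_kernel[OF t Id_in_Hom[OF Y]] by blast
qed

lemma triangle_retract_right:
  assumes t: "dist_triangle D X Y Z f g h" and f: "f = ZeroA D X Y"
  shows "\<exists>r \<in> Hom D Z Y. r \<cdot> g = Id D Y"
proof -
  have Y: "Y \<in> Ob D" using triangle_Ob[OF t] by blast
  have "Id D Y \<cdot> f = ZeroA D X Y" using f Comp_Id_left[OF triangle_Hom(1)[OF t]] by simp
  then show ?thesis using triangle_weak_cokernel[OF t Id_in_Hom[OF Y]] by blast
qed

text \<open>
  Used to show that aisles are orthogonal classes without assuming closure under summands: the
  unwanted term of a decomposition triangle has zero identity.
\<close>

lemma triangle_zero_cone_iso:
  assumes t: "dist_triangle D X Y Z f g h" and Z: "Id D Z = ZeroA D Z Z"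
  shows "isomorphic D X Y"
proof -
  have ZO: "zero_object D Z" using zero_object_if_Id_Zero[OF triangle_Ob(3)[OF t] Z] .
  have X: "X \<in> Ob D" and Y: "Y \<in> Ob D" using triangle_Ob[OF t] by blast+
  note f = triangle_Hom(1)[OF t]
  have g: "g = ZeroA D Y Z" using zero_object_Hom(1)[OF ZO Y triangle_Hom(2)[OF t]] .
  have h: "h = ZeroA D Z (ShO D X)"
    using zero_object_Hom(2)[OF ZO ShO_in_Ob[OF X] triangle_Hom(3)[OF t]] .
  obtain s where s: "s \<in> Hom D Y X" "f \<cdot> s = Id D Y" using triangle_retract_left[OF t g] by blast
  have "f \<cdot> (s \<cdot> f) = f \<cdot> Id D X"
    using Comp_assoc[OF f s(1) f] s(2) Comp_Id_left[OF f] Comp_Id_right[OF f] by simp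
  then have "s \<cdot> f = Id D X"
    using triangle_monic[OF t h Comp_in_Hom[OF f s(1)] Id_in_Hom[OF X]] by blast
  then show ?thesis unfolding isomorphic_def is_iso_def using f s by blast
qed

text \<open>
  TR1 only embeds g as the first arrow of a triangle. As the shift is merely essentially surjective,
  the third object of that triangle is first replaced by an isomorphic one of the form \<open>X[1]\<close>; then
  TR2 rotates back.
\<close>

lemma cocone_exists:
  assumes g: "g \<in> Hom D Y Z"
  shows "\<exists>X f h. dist_triangle D X Y Z f g h"
proof -
  obtain W a b where t: "dist_triangle D Y Z W g a b" using TR1_cone[OF g] by blast
  note a = triangle_Hom(2)[OF t] and b = triangle_Hom(3)[OF t]
  have Y: "Y \<in> Ob D" and Z: "Z \<in> Ob D" using Hom_objects g by blast+
  obtain X c where X: "X \<in> Ob D" and "is_iso D (ShO D X) W c"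
    using ShO_ess_surj triangle_Ob(3)[OF t] unfolding isomorphic_def by metis
  then obtain e where c: "c \<in> Hom D (ShO D X) W" and e: "e \<in> Hom D W (ShO D X)"
    and ce: "c \<cdot> e = Id D W" and ec: "e \<cdot> c = Id D (ShO D X)"
    unfolding is_iso_def by blast
  have bc: "b \<cdot> c \<in> Hom D (ShO D X) (ShO D Y)" using Comp_in_Hom[OF c b] .
  have "(b \<cdot> c) \<cdot> e = b" using Comp_assoc[OF e c b] ce Comp_Id_right[OF b] by simp
  then have 1: "ShA D (Id D Y) \<cdot> b = (b \<cdot> c) \<cdot> e"
    using ShA_Id[OF Y] Comp_Id_left[OF b] by simp
  have "dist_triangle D Y Z (ShO D X) g (e \<cdot> a) (b \<cdot> c)"
  proof (rule TR1_iso[OF t g _ bc is_iso_Id[OF Y] is_iso_Id[OF Z]])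
    show "e \<cdot> a \<in> Hom D Z (ShO D X)" using Comp_in_Hom[OF a e] .
    show "is_iso D W (ShO D X) e" unfolding is_iso_def using c e ce ec by blast
    show "Id D Z \<cdot> g = g \<cdot> Id D Y" using Comp_Id_left[OF g] Comp_Id_right[OF g] by simp
    show "e \<cdot> a = (e \<cdot> a) \<cdot> Id D Z" using Comp_Id_right[OF Comp_in_Hom[OF a e]] by simp
  qed (rule 1)
  moreover obtain f where f: "f \<in> Hom D X Y" "ShA D f = NegA D (b \<cdot> c)"
    using ShA_full[OF X Y Neg_in_Hom[OF bc]] .
  ultimately have "dist_triangle D Y Z (ShO D X) g (e \<cdot> a) (NegA D (ShA D f))"
    using Neg_Neg[OF bc] by simp
  then show ?thesis using TR2[OF f(1) g Comp_in_Hom[OF a e]] by blast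
qed

text \<open>
  The complement is the cocone of the retraction p. Its connecting arrow vanishes because p is
  split, so the inclusion j of the cocone is monic, and the remaining direct sum identities can be
  checked after composing with j.
\<close>

lemma retract_direct_sum:
  assumes "retract A P" shows "\<exists>B. direct_sum D A B P"
proof -
  obtain i p where i: "i \<in> Hom D A P" and p: "p \<in> Hom D P A" and pi: "p \<cdot> i = Id D A"
    using assms unfolding retract_def by blast
  have A: "A \<in> Ob D" and P: "P \<in> Ob D" using Hom_objects i by blast+
  obtain B j h where t: "dist_triangle D B P A j p h" using cocone_exists[OF p] by blast
  note j = triangle_Hom(1)[OF t] and hh = triangle_Hom(3)[OF t]
  have B: "B \<in> Ob D" using triangle_Ob[OF t] by blast
  have SB: "ShO D B \<in> Ob D" using ShO_in_Ob[OF B] .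
  have pj: "p \<cdot> j = ZeroA D B A" using triangle_Comp_Zero[OF t] .
  have hp: "h \<cdot> p = ZeroA D P (ShO D B)" using triangle_Comp_Zero[OF triangle_rotate[OF t]] .
  have h0: "h = ZeroA D A (ShO D B)"
    using Comp_assoc[OF i p hh] pi hp Comp_Id_right[OF hh] Comp_Zero_left[OF SB i] by simp
  note mono = triangle_monic[OF t h0]
  have ip: "i \<cdot> p \<in> Hom D P P" using Comp_in_Hom[OF p i] .
  note nip = Neg_in_Hom[OF ip] and idP = Id_in_Hom[OF P]
  \<comment> \<open>The second projection q is the lift of \<open>Id P - i \<cdot> p\<close> along j.\<close>
  let ?d = "AddA D (NegA D (i \<cdot> p)) (Id D P)"
  have d: "?d \<in> Hom D P P" using Add_in_Hom[OF nip idP] .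
  have pip: "p \<cdot> (i \<cdot> p) = p" using Comp_assoc[OF p i p] pi Comp_Id_left[OF p] by simp
  have "p \<cdot> ?d = ZeroA D P A"
    using Comp_add_right[OF nip idP p] Comp_Neg_right[OF ip p] pip Comp_Id_right[OF p] Neg_add[OF p]
    by simp
  then obtain q where q: "q \<in> Hom D P B" and jq: "j \<cdot> q = ?d"
    using triangle_weak_kernel[OF t d] by blast
  have sum: "AddA D (i \<cdot> p) (j \<cdot> q) = Id D P"
    using jq Add_assoc[OF ip nip idP] add_Neg[OF ip] Add_Zero_left[OF idP] by simp
  have "(i \<cdot> p) \<cdot> j = ZeroA D B P"
    using Comp_assoc[OF j p i] pj Comp_Zero_right[OF B i] by simp
  then have "AddA D (ZeroA D B P) ((j \<cdot> q) \<cdot> j) = j"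
    using Comp_add_left[OF j ip Comp_in_Hom[OF q j]] sum Comp_Id_left[OF j] by simp
  then have "j \<cdot> (q \<cdot> j) = j \<cdot> Id D B"
    using Add_Zero_left[OF Comp_in_Hom[OF j Comp_in_Hom[OF q j]]] Comp_assoc[OF j q j]
      Comp_Id_right[OF j] by simp
  then have qj: "q \<cdot> j = Id D B" using mono[OF Comp_in_Hom[OF j q] Id_in_Hom[OF B]] by blast
  have "(i \<cdot> p) \<cdot> i = i" using Comp_assoc[OF i p i] pi Comp_Id_right[OF i] by simp
  then have "?d \<cdot> i = ZeroA D A P"
    using Comp_add_left[OF i nip idP] Comp_Neg_left[OF i ip] Comp_Id_left[OF i] Neg_add[OF i]
    by simp
  then have "j \<cdot> (q \<cdot> i) = j \<cdot> ZeroA D A B"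
    using Comp_assoc[OF i q j] jq Comp_Zero_right[OF A j] by simp
  then have qi: "q \<cdot> i = ZeroA D A B"
    using mono[OF Comp_in_Hom[OF i q] Zero_in_Hom[OF A B]] by blast
  show ?thesis unfolding direct_sum_def using i j p q pi qj pj qi sum by blast
qed

end

section \<open>Orthogonality and extensions\<close>

context triangulated_category
begin

lemma orth_extension_left:
  assumes t: "dist_triangle D X Y Z f g h" and o: "orth X W" "orth Z W"
  shows "orth Y W"
proof (rule orthI)
  show Y: "Y \<in> Ob D" and W: "W \<in> Ob D" using triangle_Ob[OF t] orth_Ob[OF o(1)] by blast+
  fix u assume u: "u \<in> Hom D Y W"
  obtain w where w: "w \<in> Hom D Z W" "w \<cdot> g = u"
    using triangle_weak_cokernel[OF t u orthD[OF o(1) Comp_in_Hom[OF triangle_Hom(1)[OF t] u]]] .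
  then show "u = ZeroA D Y W"
    using orthD[OF o(2) w(1)] Comp_Zero_left[OF W triangle_Hom(2)[OF t]] by simp
qed

lemma orth_extension_right:
  assumes t: "dist_triangle D X Y Z f g h" and o: "orth W X" "orth W Z"
  shows "orth W Y"
proof (rule orthI)
  show W: "W \<in> Ob D" and Y: "Y \<in> Ob D" using triangle_Ob[OF t] orth_Ob[OF o(1)] by blast+
  fix u assume u: "u \<in> Hom D W Y"
  obtain w where w: "w \<in> Hom D W X" "f \<cdot> w = u"
    using triangle_weak_kernel[OF t u orthD[OF o(2) Comp_in_Hom[OF u triangle_Hom(2)[OF t]]]] .
  then show "u = ZeroA D W Y"
    using orthD[OF o(1) w(1)] Comp_Zero_right[OF W triangle_Hom(1)[OF t]] by simp
qed

text \<open>
  Rotation exhibits Z as an extension of \<open>X[1]\<close> by Y.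
\<close>

lemma orth_cone_left:
  assumes "dist_triangle D X Y Z f g h" "orth Y W" "orth (ShO D X) W"
  shows "orth Z W"
  using orth_extension_left[OF triangle_rotate[OF assms(1)] assms(2,3)] .

text \<open>
  The object \<open>X[1]\<close> is an extension of \<open>Y[1]\<close> by Z. Testing it against \<open>W[1]\<close> avoids a negative
  shift of Z.
\<close>

lemma orth_cocone_right:
  assumes t: "dist_triangle D X Y Z f g h" and "orth W Y" "orth (ShO D W) Z"
  shows "orth W X"
proof -
  have "orth (ShO D W) (ShO D X)"
    using orth_extension_right[OF triangle_rotate[OF triangle_rotate[OF t]] assms(3)]
      assms(2) orth_ShO orth_Ob by blast
  then show ?thesis using orth_ShO triangle_Ob[OF t] orth_Ob[OF assms(2)] by blast
qed

text \<open>
  Three rotations shift a triangle up to signs of its arrows. The signs are left unspecified because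
  only membership in classes of the form \<open>X * Y\<close> is read off.
\<close>

lemma triangle_ShO:
  assumes "dist_triangle D X Y Z f g h"
  shows "\<exists>f' g' h'. dist_triangle D (ShO D X) (ShO D Y) (ShO D Z) f' g' h'"
  using triangle_rotate[OF triangle_rotate[OF triangle_rotate[OF assms]]] by blast

lemma triangle_iso_middle:
  assumes t: "dist_triangle D X Y Z f g h" and i: "isomorphic D Y Y'"
  shows "\<exists>f' g'. dist_triangle D X Y' Z f' g' h"
proof -
  obtain a b where ab: "a \<in> Hom D Y Y'" "b \<in> Hom D Y' Y" "b \<cdot> a = Id D Y" "is_iso D Y Y' a"
    using i unfolding isomorphic_def is_iso_def by blast
  note f = triangle_Hom(1)[OF t] and g = triangle_Hom(2)[OF t] and h = triangle_Hom(3)[OF t]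
  note O = triangle_Ob[OF t]
  have "dist_triangle D X Y' Z (a \<cdot> f) (g \<cdot> b) h"
  proof (rule TR1_iso[OF t Comp_in_Hom[OF f ab(1)] Comp_in_Hom[OF ab(2) g] h
        is_iso_Id[OF O(1)] ab(4) is_iso_Id[OF O(3)]])
    show "a \<cdot> f = (a \<cdot> f) \<cdot> Id D X" using Comp_Id_right[OF Comp_in_Hom[OF f ab(1)]] by simp
    show "Id D Z \<cdot> g = (g \<cdot> b) \<cdot> a"
      using Comp_assoc[OF ab(1,2) g] ab(3) Comp_Id_left[OF g] Comp_Id_right[OF g] by simp
    show "ShA D (Id D X) \<cdot> h = h \<cdot> Id D Z"
      using ShA_Id[OF O(1)] Comp_Id_left[OF h] Comp_Id_right[OF h] by simp
  qed
  then show ?thesis by blast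
qed

lemma isomorphic_ShO:
  assumes "isomorphic D X Y" shows "isomorphic D (ShO D X) (ShO D Y)"
proof -
  obtain a b where ab: "a \<in> Hom D X Y" "b \<in> Hom D Y X" "b \<cdot> a = Id D X" "a \<cdot> b = Id D Y"
    using assms unfolding isomorphic_def is_iso_def by blast
  have "ShA D b \<cdot> ShA D a = Id D (ShO D X)" "ShA D a \<cdot> ShA D b = Id D (ShO D Y)"
    using ShA_Comp[OF ab(1,2)] ShA_Comp[OF ab(2,1)] ab(3,4) ShA_Id isomorphic_Ob[OF assms]
    by simp_all
  then show ?thesis
    unfolding isomorphic_def is_iso_def using ShA_in_Hom[OF ab(1)] ShA_in_Hom[OF ab(2)] by blast
qed

lemma starI: "\<lbrakk>dist_triangle D B A C f g h; B \<in> X; C \<in> Y\<rbrakk> \<Longrightarrow> A \<in> star D X Y"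
  unfolding star_def using triangle_Ob(2) by blast

lemma starE:
  assumes "A \<in> star D X Y"
  obtains B C f g h where "dist_triangle D B A C f g h" "B \<in> X" "C \<in> Y"
  using assms unfolding star_def by blast

lemma star_Ob: "star D X Y \<subseteq> Ob D"
  unfolding star_def by blast

lemma subcat_star: "subcat D (star D X Y)"
  unfolding subcat_def
proof (intro conjI ballI allI impI)
  show "star D X Y \<subseteq> Ob D" by (rule star_Ob)
  fix A B assume A: "A \<in> star D X Y" and i: "isomorphic D A B"
  obtain P Q f g h where t: "dist_triangle D P A Q f g h" "P \<in> X" "Q \<in> Y" using starE[OF A] .
  then show "B \<in> star D X Y" using triangle_iso_middle[OF t(1) i] starI by blast
qed

lemma star_orth_left:
  assumes "A \<in> star D X Y" "\<And>B. B \<in> X \<Longrightarrow> orth B W" "\<And>B. B \<in> Y \<Longrightarrow> orth B W"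
  shows "orth A W"
  using starE[OF assms(1)] orth_extension_left assms(2,3) by metis

lemma star_orth_right:
  assumes "A \<in> star D X Y" "\<And>B. B \<in> X \<Longrightarrow> orth W B" "\<And>B. B \<in> Y \<Longrightarrow> orth W B"
  shows "orth W A"
  using starE[OF assms(1)] orth_extension_right assms(2,3) by metis

lemma star_ShO_orth_left:
  assumes "A \<in> star D X Y" "\<And>B. B \<in> X \<Longrightarrow> orth (ShO D B) W"
    "\<And>B. B \<in> Y \<Longrightarrow> orth (ShO D B) W"
  shows "orth (ShO D A) W"
proof -
  obtain B C f g h where t: "dist_triangle D B A C f g h" "B \<in> X" "C \<in> Y"
    using starE[OF assms(1)] .
  then show ?thesis using triangle_ShO[OF t(1)] orth_extension_left assms(2,3) by blast
qed

section \<open>Torsion pairs and t-structures as mutually orthogonal pairs\<close>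

text \<open>
  If X has no maps to F, the decomposition triangle splits and X is a retract of an object of T;
  dually for F. Closure of T and F is only assumed for direct sums with both summands in K, so the
  complement of X has to be in K as well; it is, because K is closed under retracts.
\<close>

lemma torsion_pair_iff:
  assumes K: "summand_closed K"
  shows "torsion_pair D K (T, F) \<longleftrightarrow>
    T = K \<inter> lperp F \<and> F = K \<inter> rperp T \<and> K \<subseteq> star D T F"
proof
  assume tp: "torsion_pair D K (T, F)"
  have KO: "K \<subseteq> Ob D" using K unfolding summand_closed_def by blast
  have T: "additive_subcat D K T" and F: "additive_subcat D K F"
    and o: "\<And>A B. \<lbrakk>A \<in> T; B \<in> F\<rbrakk> \<Longrightarrow> orth A B" and s: "K \<subseteq> star D T F"
    using tp unfolding torsion_pair_def hom_zero_iff_orth by auto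
  have TK: "T \<subseteq> K" and FK: "F \<subseteq> K" using T F unfolding additive_subcat_def by blast+
  have summand: "A \<in> X" if X: "additive_subcat D K X" and P: "A \<in> K" "P \<in> X" "retract A P" for X A P
  proof -
    obtain B where B: "direct_sum D A B P" using retract_direct_sum P(3) by blast
    have "P \<in> K" using X P(2) unfolding additive_subcat_def by blast
    then have "B \<in> K" using direct_sum_retracts(2)[OF B] K unfolding summand_closed_def by blast
    then show ?thesis using X P(1,2) B unfolding additive_subcat_def by blast
  qed
  have "A \<in> T" if A: "A \<in> K" "A \<in> lperp F" for A
  proof -
    obtain P Q f g h where t: "dist_triangle D P A Q f g h" "P \<in> T" "Q \<in> F"
      using s A(1) by (blast elim: starE)
    have "g = ZeroA D A Q"
      using orthD[OF _ triangle_Hom(2)[OF t(1)]] A(2) t(3) unfolding lperp_def by blast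
    then have "retract A P"
      using triangle_retract_left[OF t(1)] triangle_Hom(1)[OF t(1)] unfolding retract_def by blast
    then show ?thesis using summand[OF T A(1) t(2)] by blast
  qed
  moreover have "A \<in> F" if A: "A \<in> K" "A \<in> rperp T" for A
  proof -
    obtain P Q f g h where t: "dist_triangle D P A Q f g h" "P \<in> T" "Q \<in> F"
      using s A(1) by (blast elim: starE)
    have "f = ZeroA D P A"
      using orthD[OF _ triangle_Hom(1)[OF t(1)]] A(2) t(2) unfolding rperp_def by blast
    then have "retract A Q"
      using triangle_retract_right[OF t(1)] triangle_Hom(2)[OF t(1)] unfolding retract_def by blast
    then show ?thesis using summand[OF F A(1) t(3)] by blast
  qed
  ultimately show "T = K \<inter> lperp F \<and> F = K \<inter> rperp T \<and> K \<subseteq> star D T F"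
    using o TK FK KO s unfolding lperp_def rperp_def by blast
next
  assume a: "T = K \<inter> lperp F \<and> F = K \<inter> rperp T \<and> K \<subseteq> star D T F"
  have KO: "K \<subseteq> Ob D" using K unfolding summand_closed_def by blast
  have TK: "T \<subseteq> K" and FK: "F \<subseteq> K" and s: "K \<subseteq> star D T F" using a by blast+
  have TO: "T \<subseteq> Ob D" and FO: "F \<subseteq> Ob D" using TK FK KO by blast+
  have sc: "summand_closed T" "summand_closed F"
    using summand_closed_Int[OF K summand_closed_lperp[OF FO]]
      summand_closed_Int[OF K summand_closed_rperp[OF TO]] a by metis+
  have "additive_subcat D K X" if X: "summand_closed X" "X \<subseteq> K" for X
    unfolding additive_subcat_def
  proof (intro conjI)
    show "subcat D X" using summand_closed_subcat X by blast
    show "X \<subseteq> K" by fact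
    show "\<exists>Z \<in> X. zero_object D Z"
      using zero_object_exists X(1) unfolding summand_closed_def by blast
    show "\<forall>A \<in> X. \<forall>B \<in> X. \<forall>P. direct_sum D A B P \<longrightarrow> P \<in> X"
      using X(1) unfolding summand_closed_def by blast
    show "\<forall>A \<in> K. \<forall>B \<in> K. \<forall>P \<in> X. direct_sum D A B P \<longrightarrow> A \<in> X"
      using X(1) direct_sum_retracts(1) unfolding summand_closed_def by blast
  qed
  then have "additive_subcat D K T" "additive_subcat D K F" using sc TK FK by blast+
  moreover have "hom_zero D T F" unfolding hom_zero_iff_orth using a unfolding lperp_def by blast
  ultimately show "torsion_pair D K (T, F)" unfolding torsion_pair_def using s by simp
qed

lemma torsion_pair_subcat:
  assumes "torsion_pair D K (T, F)" shows "subcat D T" "subcat D F"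
  using assms unfolding torsion_pair_def additive_subcat_def by auto

lemma torsion_pair_orth:
  assumes "torsion_pair D K (T, F)" "A \<in> T" "B \<in> F" shows "orth A B"
  using assms unfolding torsion_pair_def hom_zero_iff_orth by auto

lemma shift_subcat_minus_one:
  assumes "subcat D S" shows "shift_subcat D (- 1) S = {X \<in> Ob D. ShO D X \<in> S}"
proof -
  have "(\<exists>B \<in> S. isomorphic D (ShO D X) B) \<longleftrightarrow> ShO D X \<in> S" if "X \<in> Ob D" for X
    using isomorphic_refl[OF ShO_in_Ob[OF that]] subcat_iso[OF assms] isomorphic_sym by blast
  then show ?thesis unfolding shift_subcat_def by auto
qed

lemma shift_subcat_one: "shift_subcat D 1 S = {Y \<in> Ob D. \<exists>X \<in> S. isomorphic D Y (ShO D X)}"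
  unfolding shift_subcat_def by simp

text \<open>
  Negative shifts are removed once and for all by applying [1] to both arguments of Hom.
\<close>

lemma hom_zero_shift_minus_one:
  assumes "subcat D U" "subcat D V"
  shows "hom_zero D U (shift_subcat D (- 1) V) \<longleftrightarrow> (\<forall>A \<in> U. \<forall>B \<in> V. orth (ShO D A) B)"
proof -
  have U: "U \<subseteq> Ob D" and V: "V \<subseteq> Ob D" using assms unfolding subcat_def by blast+
  have "orth (ShO D A) B"
    if AB: "A \<in> U" "B \<in> V" and o: "\<forall>X \<in> Ob D. ShO D X \<in> V \<longrightarrow> orth A X" for A B
  proof -
    obtain X where X: "X \<in> Ob D" "isomorphic D (ShO D X) B" using ShO_ess_surj AB(2) V by blast
    have "ShO D X \<in> V" using subcat_iso[OF assms(2) AB(2) isomorphic_sym[OF X(2)]] .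
    then have "orth (ShO D A) (ShO D X)" using o X(1) orth_ShO AB(1) U by blast
    then show ?thesis
      using orth_retract_right isomorphic_retract[OF isomorphic_sym[OF X(2)]] by blast
  qed
  then show ?thesis
    unfolding hom_zero_iff_orth shift_subcat_minus_one[OF assms(2)] using orth_ShO U by blast
qed

lemma tors_le_iff:
  assumes "subcat D T" "subcat D F"
  shows "tors_le D (T, F') (T', F) \<longleftrightarrow> (\<forall>A \<in> T. \<forall>B \<in> F. orth A B \<and> orth (ShO D A) B)"
  unfolding tors_le_def using hom_zero_shift_minus_one[OF assms] by (auto simp: hom_zero_iff_orth)

text \<open>
  A torsion pair of the whole category with shift-closed first class; for a t-structure this is
  \<open>(D\<^sup>\<le>\<^sup>0, D\<^sup>\<ge>\<^sup>1)\<close>.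
\<close>

definition aisle_pair :: "'o set \<Rightarrow> 'o set \<Rightarrow> bool" where
  "aisle_pair A B \<longleftrightarrow> A = lperp B \<and> B = rperp A \<and> Ob D \<subseteq> star D A B \<and> (\<forall>X \<in> A. ShO D X \<in> A)"

lemma aisle_pair_iff_torsion_pair:
  "aisle_pair A B \<longleftrightarrow> torsion_pair D (Ob D) (A, B) \<and> (\<forall>X \<in> A. ShO D X \<in> A)"
proof -
  have "Ob D \<inter> lperp B = lperp B" "Ob D \<inter> rperp A = rperp A" by (auto simp: lperp_def rperp_def)
  then show ?thesis unfolding aisle_pair_def torsion_pair_iff[OF summand_closed_Ob] by blast
qed

lemma aisle_pairD:
  assumes "aisle_pair A B"
  shows "A = lperp B" "B = rperp A" "Ob D \<subseteq> star D A B" "\<And>X. X \<in> A \<Longrightarrow> ShO D X \<in> A"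
    "\<And>X Y. \<lbrakk>X \<in> A; Y \<in> B\<rbrakk> \<Longrightarrow> orth X Y" "A \<subseteq> Ob D" "B \<subseteq> Ob D"
    "summand_closed A" "summand_closed B"
proof -
  show 1: "A = lperp B" "B = rperp A" "Ob D \<subseteq> star D A B" "\<And>X. X \<in> A \<Longrightarrow> ShO D X \<in> A"
    using assms unfolding aisle_pair_def by blast+
  show "\<And>X Y. \<lbrakk>X \<in> A; Y \<in> B\<rbrakk> \<Longrightarrow> orth X Y" using 1(1) unfolding lperp_def by blast
  show A: "A \<subseteq> Ob D" using 1(1) unfolding lperp_def by blast
  show B: "B \<subseteq> Ob D" using 1(2) unfolding rperp_def by blast
  show "summand_closed A" using 1(1) summand_closed_lperp[OF B] by simp
  show "summand_closed B" using 1(2) summand_closed_rperp[OF A] by simp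
qed

lemma tge_one: "subcat D (snd s) \<Longrightarrow> tge D s 1 = {X \<in> Ob D. ShO D X \<in> snd s}"
  unfolding tge_def by (rule shift_subcat_minus_one)

text \<open>
  A t-structure is not assumed to be closed under summands, so the orthogonality description cannot
  be taken from torsion pairs. From left to right, closure under [1] is used instead: if the map \<open>X \<rightarrow> Q\<close> in the
  decomposition triangle \<open>P \<rightarrow> X \<rightarrow> Q \<rightarrow> P[1]\<close> vanishes, the identity of Q factors through \<open>P[1]\<close>,
  which is orthogonal to Q, so Q is zero and \<open>P \<cong> X\<close>. The dual case kills \<open>P[1]\<close>.
\<close>

lemma t_structure_iff_aisle_pair:
  assumes W: "subcat D (snd s)"
  shows "t_structure D s \<longleftrightarrow> aisle_pair (fst s) (tge D s 1)"
proof
  assume t: "t_structure D s"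
  let ?U = "fst s" and ?V = "tge D s 1"
  have U: "subcat D ?U" and o: "\<And>X Y. \<lbrakk>X \<in> ?U; Y \<in> ?V\<rbrakk> \<Longrightarrow> orth X Y"
    and s: "Ob D = star D ?U ?V"
    using t unfolding t_structure_def hom_zero_iff_orth by auto
  have UO: "?U \<subseteq> Ob D" using U unfolding subcat_def by blast
  have VO: "?V \<subseteq> Ob D" using tge_one[OF W] by blast
  have V: "subcat D ?V"
    unfolding subcat_def
  proof (intro conjI ballI allI impI)
    show "?V \<subseteq> Ob D" by (rule VO)
    fix A B assume A: "A \<in> ?V" and i: "isomorphic D A B"
    have "ShO D B \<in> snd s"
      using subcat_iso[OF W _ isomorphic_ShO[OF i]] A tge_one[OF W] by blast
    then show "B \<in> ?V" using tge_one[OF W] isomorphic_Ob[OF i] by blast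
  qed
  have sh: "ShO D X \<in> ?U" if "X \<in> ?U" for X
    using t that unfolding t_structure_def tle_def shift_subcat_minus_one[OF U] by auto
  have "X \<in> ?U" if X: "X \<in> lperp ?V" for X
  proof -
    have "X \<in> star D ?U ?V" using X s unfolding lperp_def by blast
    then obtain P Q f g h where d: "dist_triangle D P X Q f g h" "P \<in> ?U" "Q \<in> ?V"
      by (rule starE)
    have "g = ZeroA D X Q"
      using orthD[OF _ triangle_Hom(2)[OF d(1)]] X d(3) unfolding lperp_def by blast
    then obtain r where r: "r \<in> Hom D (ShO D P) Q" "r \<cdot> h = Id D Q"
      using triangle_retract_right[OF triangle_rotate[OF d(1)]] by blast
    have "r = ZeroA D (ShO D P) Q" using orthD[OF o[OF sh[OF d(2)] d(3)] r(1)] .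
    then have "Id D Q = ZeroA D Q Q"
      using r(2) Comp_Zero_left[OF triangle_Ob(3)[OF d(1)] triangle_Hom(3)[OF d(1)]] by simp
    then show ?thesis using triangle_zero_cone_iso[OF d(1)] subcat_iso[OF U d(2)] by blast
  qed
  moreover have "X \<in> ?V" if X: "X \<in> rperp ?U" for X
  proof -
    have "X \<in> star D ?U ?V" using X s unfolding rperp_def by blast
    then obtain P Q f g h where d: "dist_triangle D P X Q f g h" "P \<in> ?U" "Q \<in> ?V"
      by (rule starE)
    have SP: "ShO D P \<in> Ob D" using ShO_in_Ob triangle_Ob(1)[OF d(1)] by blast
    have "orth (ShO D P) (ShO D X)"
      using X d(2) orth_ShO triangle_Ob(1,2)[OF d(1)] unfolding rperp_def by blast
    then have "NegA D (ShA D f) = ZeroA D (ShO D P) (ShO D X)"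
      using orthD Neg_in_Hom[OF ShA_in_Hom[OF triangle_Hom(1)[OF d(1)]]] by blast
    then obtain k where k: "k \<in> Hom D (ShO D P) Q" "h \<cdot> k = Id D (ShO D P)"
      using triangle_retract_left[OF triangle_rotate[OF triangle_rotate[OF d(1)]]] by blast
    have "k = ZeroA D (ShO D P) Q" using orthD[OF o[OF sh[OF d(2)] d(3)] k(1)] .
    then have "Id D (ShO D P) = ZeroA D (ShO D P) (ShO D P)"
      using k(2) Comp_Zero_right[OF SP triangle_Hom(3)[OF d(1)]] by simp
    then have "isomorphic D X Q" using triangle_zero_cone_iso[OF triangle_rotate[OF d(1)]] by blast
    then show ?thesis using subcat_iso[OF V d(3)] isomorphic_sym by blast
  qed
  ultimately show "aisle_pair ?U ?V"
    unfolding aisle_pair_def using o sh s UO VO unfolding lperp_def rperp_def by blast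
next
  let ?U = "fst s" and ?V = "tge D s 1"
  assume a: "aisle_pair ?U ?V"
  note ap = aisle_pairD[OF a]
  have U: "subcat D ?U" using summand_closed_subcat ap(8) by blast
  have "?U \<subseteq> tle D s 1"
    unfolding tle_def shift_subcat_minus_one[OF U] using ap(4,6) by auto
  moreover have "X \<in> snd s" if X: "X \<in> ?V" for X
  proof -
    obtain Y where Y: "Y \<in> Ob D" "isomorphic D (ShO D Y) X" using ShO_ess_surj X ap(7) by blast
    have "orth A Y" if A: "A \<in> ?U" for A
    proof -
      have "orth (ShO D A) X" using ap(4,5) A X by blast
      then have "orth (ShO D A) (ShO D Y)"
        using orth_retract_right isomorphic_retract[OF Y(2)] by blast
      then show ?thesis using orth_ShO A ap(6) Y(1) by blast
    qed
    then have "Y \<in> ?V" using ap(2) Y(1) unfolding rperp_def by blast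
    then show ?thesis using tge_one[OF W] subcat_iso[OF W _ Y(2)] by blast
  qed
  ultimately show "t_structure D s"
    unfolding t_structure_def hom_zero_iff_orth using U W ap(3,5) star_Ob by blast
qed

text \<open>
  Essential surjectivity of the shift: every object of W is isomorphic to some \<open>X[1]\<close>, and whether
  \<open>X[1]\<close> lies in W is recorded by \<open>tge\<close>.
\<close>

lemma coaisle_eqI:
  assumes "subcat D W" "subcat D W'" "tge D (U, W) 1 = tge D (U, W') 1"
  shows "W = W'"
proof -
  have "Y \<in> W'" if W: "subcat D W" "subcat D W'" and Y: "Y \<in> W"
    and e: "tge D (U, W) 1 = tge D (U, W') 1" for W W' Y
  proof -
    obtain X where X: "X \<in> Ob D" "isomorphic D (ShO D X) Y"
      using ShO_ess_surj Y W(1) unfolding subcat_def by blast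
    then have "ShO D X \<in> W" using subcat_iso[OF W(1) Y] isomorphic_sym by blast
    then have "X \<in> tge D (U, W') 1" using tge_one[of "(U, W)"] W(1) X(1) e by auto
    then show ?thesis using tge_one[of "(U, W')"] W(2) subcat_iso[OF W(2) _ X(2)] by auto
  qed
  then show ?thesis using assms by blast
qed

end

section \<open>Torsion pairs between two t-structures\<close>

lemma inverse_order_bijectionsI:
  assumes "\<And>a. a \<in> A \<Longrightarrow> \<phi> a \<in> B" "\<And>b. b \<in> B \<Longrightarrow> \<psi> b \<in> A"
    and "\<And>a. a \<in> A \<Longrightarrow> \<psi> (\<phi> a) = a" "\<And>b. b \<in> B \<Longrightarrow> \<phi> (\<psi> b) = b"
    and "\<And>a a'. \<lbrakk>a \<in> A; a' \<in> A; leA a a'\<rbrakk> \<Longrightarrow> leB (\<phi> a) (\<phi> a')"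
    and "\<And>b b'. \<lbrakk>b \<in> B; b' \<in> B; leB b b'\<rbrakk> \<Longrightarrow> leA (\<psi> b) (\<psi> b')"
  shows "inverse_order_bijections A leA B leB \<phi> \<psi>"
  unfolding inverse_order_bijections_def
proof (intro conjI)
  show "bij_betw \<phi> A B" by (rule bij_betw_byWitness[where f' = \<psi>]) (use assms(1-4) in auto)
  show "bij_betw \<psi> B A" by (rule bij_betw_byWitness[where f' = \<phi>]) (use assms(1-4) in auto)
qed (use assms in \<open>auto intro: monotone_onI\<close>)

locale t_structure_interval = triangulated_category D
  for D :: "('o, 'm) tricat" (structure) +
  fixes s1 s2 :: "'o set \<times> 'o set"
  assumes t_structure_s1: "t_structure D s1"
    and t_structure_s2: "t_structure D s2"
    and aisle_sub: "fst s1 \<subseteq> fst s2"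
begin

abbreviation "A1 \<equiv> fst s1"
abbreviation "A2 \<equiv> fst s2"
abbreviation "B1 \<equiv> tge D s1 1"
abbreviation "B2 \<equiv> tge D s2 1"
abbreviation "H \<equiv> interval_heart D s1 s2"

lemma aisle_pair_s1: "aisle_pair A1 B1" and aisle_pair_s2: "aisle_pair A2 B2"
  using t_structure_s1 t_structure_s2 t_structure_iff_aisle_pair unfolding t_structure_def by blast+

lemmas A1_eq_lperp = aisle_pairD(1)[OF aisle_pair_s1]
  and B1_eq_rperp = aisle_pairD(2)[OF aisle_pair_s1]
  and A1_B1_decomposition = aisle_pairD(3)[OF aisle_pair_s1]
  and ShO_A1 = aisle_pairD(4)[OF aisle_pair_s1]
  and orth_A1_B1 = aisle_pairD(5)[OF aisle_pair_s1]
  and A1_Ob = aisle_pairD(6)[OF aisle_pair_s1]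
  and B1_Ob = aisle_pairD(7)[OF aisle_pair_s1]
  and summand_closed_A1 = aisle_pairD(8)[OF aisle_pair_s1]
  and summand_closed_B1 = aisle_pairD(9)[OF aisle_pair_s1]
  and A2_eq_lperp = aisle_pairD(1)[OF aisle_pair_s2]
  and B2_eq_rperp = aisle_pairD(2)[OF aisle_pair_s2]
  and A2_B2_decomposition = aisle_pairD(3)[OF aisle_pair_s2]
  and ShO_A2 = aisle_pairD(4)[OF aisle_pair_s2]
  and orth_A2_B2 = aisle_pairD(5)[OF aisle_pair_s2]
  and A2_Ob = aisle_pairD(6)[OF aisle_pair_s2]
  and B2_Ob = aisle_pairD(7)[OF aisle_pair_s2]
  and summand_closed_A2 = aisle_pairD(8)[OF aisle_pair_s2]
  and summand_closed_B2 = aisle_pairD(9)[OF aisle_pair_s2]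

lemma orth_A1_B2: "\<lbrakk>A \<in> A1; B \<in> B2\<rbrakk> \<Longrightarrow> orth A B"
  using aisle_sub orth_A2_B2 by blast

lemma B2_sub_B1: "B2 \<subseteq> B1"
  using orth_A1_B2 B1_eq_rperp B2_Ob unfolding rperp_def by blast

lemma H_eq: "H = A2 \<inter> B1"
  by (simp add: interval_heart_def)

lemma summand_closed_H: "summand_closed H"
  unfolding H_eq using summand_closed_Int summand_closed_B1 summand_closed_A2 by blast

lemma tors_H_sub:
  assumes "torsion_pair D H (T, F)"
  shows "T \<subseteq> A2" "T \<subseteq> B1" "F \<subseteq> A2" "F \<subseteq> B1" "T \<subseteq> Ob D" "F \<subseteq> Ob D"
proof -
  have "T \<subseteq> H" "F \<subseteq> H" using assms unfolding torsion_pair_def additive_subcat_def by auto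
  then show "T \<subseteq> A2" "T \<subseteq> B1" "F \<subseteq> A2" "F \<subseteq> B1" "T \<subseteq> Ob D" "F \<subseteq> Ob D"
    using H_eq A2_Ob by blast+
qed

text \<open>
  The inclusion from right to left decomposes X by the first t-structure as \<open>P \<rightarrow> X \<rightarrow> Q\<close>. The cone
  Q inherits orthogonality to F and \<open>B\<^sub>2\<close> from X and \<open>P[1]\<close>, hence lies in H and then in T.
\<close>

lemma star_eq_lperp:
  assumes tp: "torsion_pair D H (T, F)"
  shows "star D A1 T = lperp (F \<union> B2)"
proof
  note sub = tors_H_sub[OF tp]
  show "star D A1 T \<subseteq> lperp (F \<union> B2)"
  proof
    fix X assume X: "X \<in> star D A1 T"
    have "orth X W" if "W \<in> F \<union> B2" for W
      using star_orth_left[OF X, of W] that torsion_pair_orth[OF tp] orth_A1_B2 orth_A1_B1 orth_A2_B2 sub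
      by blast
    then show "X \<in> lperp (F \<union> B2)" using X star_Ob unfolding lperp_def by blast
  qed
  show "lperp (F \<union> B2) \<subseteq> star D A1 T"
  proof
    fix X assume X: "X \<in> lperp (F \<union> B2)"
    then have "X \<in> Ob D" unfolding lperp_def by blast
    then obtain P Q f g h where t: "dist_triangle D P X Q f g h" "P \<in> A1" "Q \<in> B1"
      using A1_B1_decomposition by (blast elim: starE)
    have o: "orth Q W" if W: "W \<in> F \<union> B2" for W
    proof (rule orth_cone_left[OF t(1)])
      show "orth X W" using X W unfolding lperp_def by blast
      show "orth (ShO D P) W" using ShO_A1[OF t(2)] W sub(4) B2_sub_B1 orth_A1_B1 by blast
    qed
    have QO: "Q \<in> Ob D" using triangle_Ob[OF t(1)] by blast
    then have "Q \<in> A2" using o A2_eq_lperp unfolding lperp_def by blast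
    then have "Q \<in> H \<inter> lperp F" using o t(3) QO unfolding H_eq lperp_def by blast
    then have "Q \<in> T" using tp torsion_pair_iff[OF summand_closed_H] by blast
    then show "X \<in> star D A1 T" using starI[OF t(1,2)] by blast
  qed
qed

text \<open>
  Dual to the previous lemma, with the decomposition by the second t-structure.
\<close>

lemma star_eq_rperp:
  assumes tp: "torsion_pair D H (T, F)"
  shows "star D F B2 = rperp (A1 \<union> T)"
proof
  note sub = tors_H_sub[OF tp]
  show "star D F B2 \<subseteq> rperp (A1 \<union> T)"
  proof
    fix X assume X: "X \<in> star D F B2"
    have "orth W X" if "W \<in> A1 \<union> T" for W
      using star_orth_right[OF X, of W] that torsion_pair_orth[OF tp] orth_A1_B2 orth_A1_B1 orth_A2_B2 sub
      by blast
    then show "X \<in> rperp (A1 \<union> T)" using X star_Ob unfolding rperp_def by blast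
  qed
  show "rperp (A1 \<union> T) \<subseteq> star D F B2"
  proof
    fix X assume X: "X \<in> rperp (A1 \<union> T)"
    then have "X \<in> Ob D" unfolding rperp_def by blast
    then obtain P Q f g h where t: "dist_triangle D P X Q f g h" "P \<in> A2" "Q \<in> B2"
      using A2_B2_decomposition by (blast elim: starE)
    have o: "orth W P" if W: "W \<in> A1 \<union> T" for W
    proof (rule orth_cocone_right[OF t(1)])
      show "orth W X" using X W unfolding rperp_def by blast
      have "W \<in> A2" using W sub(1) aisle_sub by blast
      then show "orth (ShO D W) Q" using ShO_A2 orth_A2_B2 t(3) by blast
    qed
    have PO: "P \<in> Ob D" using triangle_Ob[OF t(1)] by blast
    then have "P \<in> B1" using o B1_eq_rperp unfolding rperp_def by blast
    then have "P \<in> H \<inter> rperp T" using o t(2) PO unfolding H_eq rperp_def by blast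
    then have "P \<in> F" using tp torsion_pair_iff[OF summand_closed_H] by blast
    then show "X \<in> star D F B2" using starI[OF t(1) _ t(3)] by blast
  qed
qed

text \<open>
  Let E be the \<open>A\<^sub>2\<close>-part of X and M the \<open>B\<^sub>1\<close>-part of E, so M lies in H and has an F-part \<open>F\<^sub>0\<close>. The
  cut is made at the cocone P of the composite \<open>E \<rightarrow> M \<rightarrow> F\<^sub>0\<close>. The octahedron on \<open>P \<rightarrow> E \<rightarrow> X\<close> shows
  that the cone of \<open>P \<rightarrow> X\<close> is an extension of the \<open>B\<^sub>2\<close>-part of X by \<open>F\<^sub>0\<close>. The octahedron on
  \<open>E \<rightarrow> M \<rightarrow> F\<^sub>0\<close> shows that \<open>P[1]\<close> is an extension of \<open>T\<^sub>0[1]\<close> by \<open>A[1]\<close>; this gives the vanishing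
  conditions that place P in \<open>A\<^sub>1 * T\<close> without desuspending the triangle.
\<close>

lemma star_decomposition:
  assumes tp: "torsion_pair D H (T, F)" and X: "X \<in> Ob D"
  shows "X \<in> star D (star D A1 T) (star D F B2)"
proof -
  note sub = tors_H_sub[OF tp]
  obtain E B a b c where t1: "dist_triangle D E X B a b c" "E \<in> A2" "B \<in> B2"
    using A2_B2_decomposition X by (blast elim: starE)
  obtain A M p q r where t2: "dist_triangle D A E M p q r" "A \<in> A1" "M \<in> B1"
    using A1_B1_decomposition triangle_Ob(1)[OF t1(1)] by (blast elim: starE)
  have "orth M W" if W: "W \<in> B2" for W
    using orth_cone_left[OF t2(1)] orth_A2_B2[OF t1(2) W] orth_A1_B2[OF ShO_A1[OF t2(2)] W] by blast
  then have "M \<in> H"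
    using t2(3) A2_eq_lperp triangle_Ob[OF t2(1)] unfolding H_eq lperp_def by blast
  then have "M \<in> star D T F" using tp unfolding torsion_pair_def by auto
  then obtain T0 F0 u v w where t3: "dist_triangle D T0 M F0 u v w" "T0 \<in> T" "F0 \<in> F"
    by (rule starE)
  \<comment> \<open>The octahedron that computes the cone Q of the composite from P to X.\<close>
  obtain P e h where t4: "dist_triangle D P E F0 e (v \<cdot> q) h"
    using cocone_exists[OF Comp_in_Hom[OF triangle_Hom(2)[OF t2(1)] triangle_Hom(2)[OF t3(1)]]]
    by blast
  obtain Q k l where t5: "dist_triangle D P X Q (a \<cdot> e) k l"
    using TR1_cone[OF Comp_in_Hom[OF triangle_Hom(1)[OF t4] triangle_Hom(1)[OF t1(1)]]] by blast
  obtain x y z where "dist_triangle D F0 Q B x y z" using TR4[OF t4 t1(1) t5] by blast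
  then have Q: "Q \<in> star D F B2" using starI t3(3) t1(3) by blast
  \<comment> \<open>After one rotation, A[1], P[1] and T0[1] are the cones of the two arrows and their composite.\<close>
  obtain x y z where t6: "dist_triangle D (ShO D A) (ShO D P) (ShO D T0) x y z"
    using TR4[OF triangle_rotate[OF t2(1)] triangle_rotate[OF t3(1)] triangle_rotate[OF t4]] by blast
  have PO: "P \<in> Ob D" using triangle_Ob[OF t4] by blast
  have "orth P W" if W: "W \<in> F \<union> B2" for W
  proof -
    have WO: "W \<in> Ob D" using W sub(6) B2_Ob by blast
    have "orth A W" using W t2(2) sub(4) orth_A1_B1 orth_A1_B2 by blast
    moreover have "orth T0 W" using W t3(2) torsion_pair_orth[OF tp] sub(1) orth_A2_B2 by blast
    ultimately have "orth (ShO D P) (ShO D W)"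
      using orth_extension_left[OF t6] orth_ShO WO orth_Ob by blast
    then show ?thesis using orth_ShO PO WO by blast
  qed
  then have "P \<in> star D A1 T" using PO unfolding star_eq_lperp[OF tp] lperp_def by blast
  then show ?thesis using starI[OF t5 _ Q] by blast
qed

lemma psi_torsion_pair:
  assumes tp: "torsion_pair D H (T, F)"
  shows "torsion_pair D (Ob D) (star D A1 T, star D F B2)"
proof -
  let ?U = "star D A1 T" and ?V = "star D F B2"
  note sub = tors_H_sub[OF tp]
  have "lperp ?V = lperp (F \<union> B2)"
  proof
    have "F \<union> B2 \<subseteq> ?V"
      unfolding star_eq_rperp[OF tp]
      using torsion_pair_orth[OF tp] orth_A1_B2 orth_A1_B1 orth_A2_B2 B2_Ob sub unfolding rperp_def by blast
    then show "lperp ?V \<subseteq> lperp (F \<union> B2)" unfolding lperp_def by blast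
    show "lperp (F \<union> B2) \<subseteq> lperp ?V"
      unfolding lperp_def using star_orth_right by blast
  qed
  moreover have "rperp ?U = rperp (A1 \<union> T)"
  proof
    have "A1 \<union> T \<subseteq> ?U"
      unfolding star_eq_lperp[OF tp]
      using torsion_pair_orth[OF tp] orth_A1_B2 orth_A1_B1 A1_Ob orth_A2_B2 sub unfolding lperp_def by blast
    then show "rperp ?U \<subseteq> rperp (A1 \<union> T)" unfolding rperp_def by blast
    show "rperp (A1 \<union> T) \<subseteq> rperp ?U"
      unfolding rperp_def using star_orth_left by blast
  qed
  ultimately have "?U = Ob D \<inter> lperp ?V" "?V = Ob D \<inter> rperp ?U"
    using star_eq_lperp[OF tp] star_eq_rperp[OF tp] star_Ob by blast+
  then show ?thesis
    using torsion_pair_iff[OF summand_closed_Ob] star_decomposition[OF tp] by blast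
qed

lemma psi_interval:
  assumes tp: "torsion_pair D H (T, F)"
  shows "A1 \<subseteq> star D A1 T" "star D A1 T \<subseteq> A2"
proof -
  note sub = tors_H_sub[OF tp]
  show "A1 \<subseteq> star D A1 T"
    unfolding star_eq_lperp[OF tp] using orth_A1_B1 A1_Ob orth_A1_B2 sub unfolding lperp_def by blast
  show "star D A1 T \<subseteq> A2"
    unfolding star_eq_lperp[OF tp] using A2_eq_lperp unfolding lperp_def by blast
qed

lemma torsion_pair_ambient:
  assumes "torsion_pair D (Ob D) (U, V)" shows "U = lperp V" "V = rperp U" "Ob D \<subseteq> star D U V"
  using assms torsion_pair_iff[OF summand_closed_Ob, of U V] unfolding lperp_def rperp_def by blast+

lemma interval_orth:
  assumes tp: "torsion_pair D (Ob D) (U, V)" and i: "A1 \<subseteq> U" "U \<subseteq> A2"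
  shows "V \<subseteq> B1" "B2 \<subseteq> V"
proof -
  show "V \<subseteq> B1"
    using B1_eq_rperp torsion_pair_ambient(2)[OF tp] i(1) unfolding rperp_def by blast
  show "B2 \<subseteq> V"
    using B2_eq_rperp torsion_pair_ambient(2)[OF tp] i(2) unfolding rperp_def by blast
qed

text \<open>
  In the decomposition triangle \<open>P \<rightarrow> X \<rightarrow> Q\<close> of an object of H, the cocone P is in \<open>B\<^sub>1\<close> because X
  and Q are and \<open>A\<^sub>1\<close> is closed under [1]; dually the cone Q is in \<open>A\<^sub>2\<close>.
\<close>

lemma phi_torsion_pair:
  assumes tp: "torsion_pair D (Ob D) (U, V)" and i: "A1 \<subseteq> U" "U \<subseteq> A2"
  shows "torsion_pair D H (U \<inter> B1, V \<inter> A2)"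
proof -
  note amb = torsion_pair_ambient[OF tp]
  note sub = interval_orth[OF tp i]
  have dec: "X \<in> star D (U \<inter> B1) (V \<inter> A2)" if X: "X \<in> H" for X
  proof -
    have "X \<in> Ob D" using X H_eq A2_Ob by blast
    then obtain P Q f g h where t: "dist_triangle D P X Q f g h" "P \<in> U" "Q \<in> V"
      using amb(3) by (blast elim: starE)
    have PO: "P \<in> Ob D" and QO: "Q \<in> Ob D" using triangle_Ob[OF t(1)] by blast+
    have "orth W P" if W: "W \<in> A1" for W
    proof (rule orth_cocone_right[OF t(1)])
      show "orth W X" using orth_A1_B1 W X H_eq by blast
      show "orth (ShO D W) Q" using ShO_A1 orth_A1_B1 W sub(1) t(3) by blast
    qed
    then have "P \<in> B1" using B1_eq_rperp PO unfolding rperp_def by blast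
    moreover have "orth Q W" if W: "W \<in> B2" for W
    proof (rule orth_cone_left[OF t(1)])
      show "orth X W" using orth_A2_B2 W X H_eq by blast
      show "orth (ShO D P) W" using ShO_A2 orth_A2_B2 W i(2) t(2) by blast
    qed
    then have "Q \<in> A2" using A2_eq_lperp QO unfolding lperp_def by blast
    ultimately show ?thesis using starI[OF t(1)] t(2,3) by blast
  qed
  have UV: "orth A B" if "A \<in> U" "B \<in> V" for A B using torsion_pair_orth[OF tp that] .
  have "X \<in> U" if X: "X \<in> H" "X \<in> lperp (V \<inter> A2)" for X
  proof -
    obtain P Q f g h where t: "dist_triangle D P X Q f g h" "P \<in> U" "Q \<in> V \<inter> A2"
      using dec[OF X(1)] by (blast elim: starE)
    have "g = ZeroA D X Q"
      using orthD[OF _ triangle_Hom(2)[OF t(1)]] X(2) t(3) unfolding lperp_def by blast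
    then have "retract X P"
      using triangle_retract_left[OF t(1)] triangle_Hom(1)[OF t(1)] unfolding retract_def by blast
    then have "orth X W" if "W \<in> V" for W using orth_retract_left UV t(2) that by blast
    then show ?thesis using amb(1) triangle_Ob[OF t(1)] unfolding lperp_def by blast
  qed
  moreover have "X \<in> V" if X: "X \<in> H" "X \<in> rperp (U \<inter> B1)" for X
  proof -
    obtain P Q f g h where t: "dist_triangle D P X Q f g h" "P \<in> U \<inter> B1" "Q \<in> V"
      using dec[OF X(1)] by (blast elim: starE)
    have "f = ZeroA D P X"
      using orthD[OF _ triangle_Hom(1)[OF t(1)]] X(2) t(2) unfolding rperp_def by blast
    then have "retract X Q"
      using triangle_retract_right[OF t(1)] triangle_Hom(2)[OF t(1)] unfolding retract_def by blast
    then have "orth W X" if "W \<in> U" for W using orth_retract_right UV t(3) that by blast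
    then show ?thesis using amb(2) triangle_Ob[OF t(1)] unfolding rperp_def by blast
  qed
  ultimately have "U \<inter> B1 = H \<inter> lperp (V \<inter> A2)" "V \<inter> A2 = H \<inter> rperp (U \<inter> B1)"
    using UV i(2) sub(1) A2_Ob unfolding H_eq
    by (auto simp: lperp_def rperp_def)
  then show ?thesis using torsion_pair_iff[OF summand_closed_H] dec by blast
qed

lemma phi_psi:
  assumes tp: "torsion_pair D H (T, F)"
  shows "star D A1 T \<inter> B1 = T" "star D F B2 \<inter> A2 = F"
proof -
  note eq = tp[unfolded torsion_pair_iff[OF summand_closed_H]]
  have "lperp (F \<union> B2) = lperp F \<inter> lperp B2" unfolding lperp_def by blast
  then have "star D A1 T \<inter> B1 = H \<inter> lperp F"
    unfolding star_eq_lperp[OF tp] H_eq A2_eq_lperp[symmetric] by blast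
  also have "\<dots> = T" by (rule sym[OF conjunct1[OF eq]])
  finally show "star D A1 T \<inter> B1 = T" .
  have "rperp (A1 \<union> T) = rperp A1 \<inter> rperp T" unfolding rperp_def by blast
  then have "star D F B2 \<inter> A2 = H \<inter> rperp T"
    unfolding star_eq_rperp[OF tp] H_eq B1_eq_rperp[symmetric] by blast
  also have "\<dots> = F" by (rule sym[OF conjunct1[OF conjunct2[OF eq]]])
  finally show "star D F B2 \<inter> A2 = F" .
qed

lemma psi_phi:
  assumes tp: "torsion_pair D (Ob D) (U, V)" and i: "A1 \<subseteq> U" "U \<subseteq> A2"
  shows "star D A1 (U \<inter> B1) = U" "star D (V \<inter> A2) B2 = V"
proof -
  note amb = torsion_pair_ambient[OF tp]
  note sub = interval_orth[OF tp i]
  note UV = torsion_pair_orth[OF tp]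
  show "star D A1 (U \<inter> B1) = U"
  proof
    show "star D A1 (U \<inter> B1) \<subseteq> U"
    proof
      fix X assume X: "X \<in> star D A1 (U \<inter> B1)"
      have "orth X W" if "W \<in> V" for W using star_orth_left[OF X, of W] UV i(1) that by blast
      then show "X \<in> U" using amb(1) X star_Ob unfolding lperp_def by blast
    qed
    show "U \<subseteq> star D A1 (U \<inter> B1)"
      unfolding star_eq_lperp[OF phi_torsion_pair[OF assms]]
      using amb(1) sub(2) unfolding lperp_def by blast
  qed
  show "star D (V \<inter> A2) B2 = V"
  proof
    show "star D (V \<inter> A2) B2 \<subseteq> V"
    proof
      fix X assume X: "X \<in> star D (V \<inter> A2) B2"
      have "orth W X" if "W \<in> U" for W using star_orth_right[OF X, of W] UV sub(2) that by blast
      then show "X \<in> V" using amb(2) X star_Ob unfolding rperp_def by blast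
    qed
    show "V \<subseteq> star D (V \<inter> A2) B2"
      unfolding star_eq_rperp[OF phi_torsion_pair[OF assms]]
      using amb(2) i(1) unfolding rperp_def by blast
  qed
qed

text \<open>
  The conditions on shifted Hom-groups in the relation on torsion pairs hold automatically here,
  because both aisles are closed under [1].
\<close>

lemma tors_interval_iff:
  "(U, V) \<in> tors_interval D s1 s2 \<longleftrightarrow>
    torsion_pair D (Ob D) (U, V) \<and> A1 \<subseteq> U \<and> U \<subseteq> A2"
proof (cases "torsion_pair D (Ob D) (U, V)")
  case True
  note amb = torsion_pair_ambient[OF True] and sc = torsion_pair_subcat[OF True]
  have A: "subcat D A1" "subcat D B2" using summand_closed_A1 summand_closed_B2 summand_closed_subcat by blast+
  have UO: "U \<subseteq> Ob D" using sc unfolding subcat_def by blast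
  have "tors_le D (A1, B1) (U, V) \<longleftrightarrow> A1 \<subseteq> U"
    unfolding tors_le_iff[OF A(1) sc(2)] using amb(1) ShO_A1 A1_Ob unfolding lperp_def by blast
  moreover have "tors_le D (U, V) (A2, B2) \<longleftrightarrow> U \<subseteq> A2"
  proof
    assume "tors_le D (U, V) (A2, B2)"
    then show "U \<subseteq> A2"
      unfolding tors_le_iff[OF sc(1) A(2)] using A2_eq_lperp UO unfolding lperp_def by blast
  next
    assume "U \<subseteq> A2"
    then show "tors_le D (U, V) (A2, B2)"
      unfolding tors_le_iff[OF sc(1) A(2)] using ShO_A2 orth_A2_B2 by blast
  qed
  ultimately show ?thesis using True by (simp add: tors_interval_def tors_def)
qed (simp add: tors_interval_def tors_def)

text \<open>
  The conditions on T and \<open>F'\<close> propagate to the extensions, since all other pairs of constituents are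
  orthogonal, also after shifting the first one, by the inclusions between the two t-structures.
\<close>

lemma psi_orth:
  assumes tp: "torsion_pair D H (T, F)" "torsion_pair D H (T', F')"
    and le: "tors_le D (T, F) (T', F')" and A: "A \<in> star D A1 T" and B: "B \<in> star D F' B2"
  shows "orth A B" "orth (ShO D A) B"
proof -
  note sub = tors_H_sub[OF tp(1)] and sub' = tors_H_sub[OF tp(2)]
  have le': "\<And>A B. \<lbrakk>A \<in> T; B \<in> F'\<rbrakk> \<Longrightarrow> orth A B \<and> orth (ShO D A) B"
    using le tors_le_iff[OF torsion_pair_subcat(1)[OF tp(1)] torsion_pair_subcat(2)[OF tp(2)]]
    by blast
  have *: "orth A W \<and> orth (ShO D A) W" if "W \<in> F' \<union> B2" for W
  proof
    have A1W: "orth X W" if "X \<in> A1" for X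
      using that \<open>W \<in> F' \<union> B2\<close> orth_A1_B1 orth_A1_B2 sub'(4) by blast
    have TW: "orth X W \<and> orth (ShO D X) W" if "X \<in> T" for X
      using that \<open>W \<in> F' \<union> B2\<close> le' ShO_A2 orth_A2_B2 sub(1) by blast
    show "orth A W" using star_orth_left[OF A] A1W TW by blast
    show "orth (ShO D A) W" using star_ShO_orth_left[OF A] A1W TW ShO_A1 by blast
  qed
  show "orth A B" "orth (ShO D A) B" using star_orth_right[OF B] * by blast+
qed

theorem tors_interval_bijection:
  "inverse_order_bijections
     (tors_interval D s1 s2) (tors_le D) (tors D H) (tors_le D)
     (\<lambda>(U, V). (U \<inter> B1, V \<inter> A2)) (\<lambda>(T, F). (star D A1 T, star D F B2))"
proof (rule inverse_order_bijectionsI; clarify)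
  fix U V assume "(U, V) \<in> tors_interval D s1 s2"
  then have t: "torsion_pair D (Ob D) (U, V)" "A1 \<subseteq> U" "U \<subseteq> A2" using tors_interval_iff by blast+
  show "(U \<inter> B1, V \<inter> A2) \<in> tors D H" using phi_torsion_pair[OF t] by (simp add: tors_def)
  show "star D A1 (U \<inter> B1) = U \<and> star D (V \<inter> A2) B2 = V" using psi_phi[OF t] by blast
  fix U' V' assume "(U', V') \<in> tors_interval D s1 s2" and le: "tors_le D (U, V) (U', V')"
  then have t': "torsion_pair D (Ob D) (U', V')" "A1 \<subseteq> U'" "U' \<subseteq> A2"
    using tors_interval_iff by blast+
  have "\<forall>A \<in> U. \<forall>B \<in> V'. orth A B \<and> orth (ShO D A) B"
    using le tors_le_iff[OF torsion_pair_subcat(1)[OF t(1)] torsion_pair_subcat(2)[OF t'(1)]]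
    by blast
  then show "tors_le D (U \<inter> B1, V \<inter> A2) (U' \<inter> B1, V' \<inter> A2)"
    using tors_le_iff[OF torsion_pair_subcat(1)[OF phi_torsion_pair[OF t]]
        torsion_pair_subcat(2)[OF phi_torsion_pair[OF t']]] by blast
next
  fix T F assume "(T, F) \<in> tors D H"
  then have t: "torsion_pair D H (T, F)" by (simp add: tors_def)
  show "(star D A1 T, star D F B2) \<in> tors_interval D s1 s2"
    using tors_interval_iff psi_torsion_pair[OF t] psi_interval[OF t] by blast
  show "star D A1 T \<inter> B1 = T \<and> star D F B2 \<inter> A2 = F" using phi_psi[OF t] by blast
  fix T' F' assume "(T', F') \<in> tors D H" and le: "tors_le D (T, F) (T', F')"
  then have t': "torsion_pair D H (T', F')" by (simp add: tors_def)
  show "tors_le D (star D A1 T, star D F B2) (star D A1 T', star D F' B2)"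
    using tors_le_iff[OF subcat_star subcat_star] psi_orth[OF t t' le] by blast
qed

section \<open>t-structures between two t-structures\<close>

lemma s_tors_iff:
  "(T, F) \<in> s_tors D H \<longleftrightarrow>
    torsion_pair D H (T, F) \<and> (\<forall>A \<in> T. \<forall>B \<in> F. orth (ShO D A) B)"
  unfolding s_tors_def s_torsion_pair_def
  using hom_zero_shift_minus_one torsion_pair_subcat by auto

text \<open>
  One inclusion tests \<open>X[1]\<close> against \<open>A\<^sub>1[1]\<close> and \<open>T[1]\<close> and uses the description of \<open>F * B\<^sub>2\<close> as a
  right orthogonal; this replaces desuspending a triangle. The other one shifts a triangle.
\<close>

lemma tge_psi:
  assumes tp: "torsion_pair D H (T, F)"
  shows "tge D (U, star D (shift_subcat D 1 F) (snd s2)) 1 = star D F B2"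
proof -
  let ?W = "star D (shift_subcat D 1 F) (snd s2)"
  note sub = tors_H_sub[OF tp]
  have W2: "subcat D (snd s2)" using t_structure_s2 unfolding t_structure_def by blast
  have B2: "B2 = {X \<in> Ob D. ShO D X \<in> snd s2}" using tge_one[OF W2] .
  have "X \<in> star D F B2" if X: "X \<in> Ob D" "ShO D X \<in> ?W" for X
  proof -
    have "orth A X" if A: "A \<in> A1 \<union> T" for A
    proof -
      have AO: "A \<in> Ob D" using A A1_Ob sub(5) by blast
      have "orth (ShO D A) (ShO D X)"
      proof (rule star_orth_right[OF X(2)])
        fix B assume "B \<in> shift_subcat D 1 F"
        then obtain F0 where F0: "F0 \<in> F" "isomorphic D B (ShO D F0)"
          unfolding shift_subcat_one by blast
        have "orth A F0" using A F0(1) torsion_pair_orth[OF tp] orth_A1_B1 sub(4) by blast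
        then show "orth (ShO D A) B"
          using orth_ShO orth_Ob orth_retract_right isomorphic_retract[OF F0(2)] by blast
      next
        fix B assume B: "B \<in> snd s2"
        then obtain Y where Y: "Y \<in> Ob D" "isomorphic D (ShO D Y) B"
          using ShO_ess_surj W2 unfolding subcat_def by blast
        then have "Y \<in> B2" using subcat_iso[OF W2 B] isomorphic_sym B2 by blast
        then have "orth A Y" using A orth_A2_B2 orth_A1_B2 sub(1) by blast
        then have "orth (ShO D A) (ShO D Y)" using orth_ShO AO Y(1) by blast
        then show "orth (ShO D A) B"
          using orth_retract_right isomorphic_retract[OF isomorphic_sym[OF Y(2)]] by blast
      qed
      then show ?thesis using orth_ShO AO X(1) by blast
    qed
    then show ?thesis using X(1) unfolding star_eq_rperp[OF tp] rperp_def by blast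
  qed
  moreover have "ShO D X \<in> ?W" if X: "X \<in> star D F B2" for X
  proof -
    obtain P Q f g h where t: "dist_triangle D P X Q f g h" "P \<in> F" "Q \<in> B2" using starE[OF X] .
    have "ShO D P \<in> shift_subcat D 1 F"
      unfolding shift_subcat_one
      using t(2) sub(6) ShO_in_Ob isomorphic_refl by blast
    moreover have "ShO D Q \<in> snd s2" using t(3) B2 by blast
    ultimately show ?thesis using triangle_ShO[OF t(1)] starI by blast
  qed
  ultimately show ?thesis
    using tge_one[of "(U, ?W)"] subcat_star subsetD[OF star_Ob] by auto
qed

lemma t_str_interval_iff:
  assumes "subcat D W"
  shows "(U, W) \<in> t_str_interval D s1 s2 \<longleftrightarrow>
    torsion_pair D (Ob D) (U, tge D (U, W) 1) \<and> (\<forall>X \<in> U. ShO D X \<in> U) \<and> A1 \<subseteq> U \<and> U \<subseteq> A2"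
  using t_structure_iff_aisle_pair[of "(U, W)"] assms
  unfolding t_str_interval_def aisle_pair_iff_torsion_pair by auto

lemma t_str_interval_subcat: "(U, W) \<in> t_str_interval D s1 s2 \<Longrightarrow> subcat D W"
  unfolding t_str_interval_def t_structure_def by auto

text \<open>
  The maps are those of the first bijection after passing from \<open>D\<^sup>\<ge>\<^sup>0\<close> to \<open>D\<^sup>\<ge>\<^sup>1\<close>. What has to be added
  is that the s-torsion condition corresponds to closure of the aisle under [1].
\<close>

theorem t_str_interval_bijection:
  "inverse_order_bijections
     (t_str_interval D s1 s2) t_str_le (s_tors D H) (tors_le D)
     (\<lambda>(U, V). (U \<inter> B1, tge D (U, V) 1 \<inter> A2))
     (\<lambda>(T, F). (star D A1 T, star D (shift_subcat D 1 F) (snd s2)))"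
proof (rule inverse_order_bijectionsI; clarify)
  fix U W assume a: "(U, W) \<in> t_str_interval D s1 s2"
  let ?V = "tge D (U, W) 1"
  have W: "subcat D W" using t_str_interval_subcat[OF a] .
  have t: "torsion_pair D (Ob D) (U, ?V)" "A1 \<subseteq> U" "U \<subseteq> A2" and sh: "\<forall>X \<in> U. ShO D X \<in> U"
    using a t_str_interval_iff[OF W] by blast+
  have p: "torsion_pair D H (U \<inter> B1, ?V \<inter> A2)" using phi_torsion_pair[OF t] .
  show "(U \<inter> B1, ?V \<inter> A2) \<in> s_tors D H"
    unfolding s_tors_iff using p sh torsion_pair_orth[OF t(1)] by blast
  have "tge D (U, star D (shift_subcat D 1 (?V \<inter> A2)) (snd s2)) 1 = ?V"
    using tge_psi[OF p] psi_phi[OF t] by simp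
  then show "star D A1 (U \<inter> B1) = U \<and> star D (shift_subcat D 1 (?V \<inter> A2)) (snd s2) = W"
    using psi_phi(1)[OF t] coaisle_eqI[OF subcat_star W] by blast
  fix U' W' assume a': "(U', W') \<in> t_str_interval D s1 s2" and le: "t_str_le (U, W) (U', W')"
  let ?V' = "tge D (U', W') 1"
  have W': "subcat D W'" using t_str_interval_subcat[OF a'] .
  have t': "torsion_pair D (Ob D) (U', ?V')" "A1 \<subseteq> U'" "U' \<subseteq> A2" and sh': "\<forall>X \<in> U'. ShO D X \<in> U'"
    using a' t_str_interval_iff[OF W'] by blast+
  have "U \<subseteq> U'" using le by (simp add: t_str_le_def)
  then show "tors_le D (U \<inter> B1, ?V \<inter> A2) (U' \<inter> B1, ?V' \<inter> A2)"
    using tors_le_iff[OF torsion_pair_subcat(1)[OF p]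
        torsion_pair_subcat(2)[OF phi_torsion_pair[OF t']]] sh' torsion_pair_orth[OF t'(1)] by blast
next
  fix T F assume "(T, F) \<in> s_tors D H"
  then have t: "torsion_pair D H (T, F)" and s: "\<forall>A \<in> T. \<forall>B \<in> F. orth (ShO D A) B"
    using s_tors_iff by blast+
  let ?U = "star D A1 T" and ?W = "star D (shift_subcat D 1 F) (snd s2)"
  note V = tge_psi[OF t, of ?U]
  note sub = tors_H_sub[OF t]
  have "ShO D X \<in> ?U" if X: "X \<in> ?U" for X
  proof -
    have "orth (ShO D X) Y" if Y: "Y \<in> F \<union> B2" for Y
    proof (rule star_ShO_orth_left[OF X])
      show "orth (ShO D B) Y" if "B \<in> A1" for B
        using ShO_A1 orth_A1_B1 orth_A1_B2 sub(4) that Y by blast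
      show "orth (ShO D B) Y" if "B \<in> T" for B
        using s ShO_A2 orth_A2_B2 sub(1) that Y by blast
    qed
    then show ?thesis
      using X star_Ob ShO_in_Ob unfolding star_eq_lperp[OF t] lperp_def by blast
  qed
  then show "(?U, ?W) \<in> t_str_interval D s1 s2"
    unfolding t_str_interval_iff[OF subcat_star] V
    using psi_torsion_pair[OF t] psi_interval[OF t] by blast
  show "?U \<inter> B1 = T \<and> tge D (?U, ?W) 1 \<inter> A2 = F" unfolding V using phi_psi[OF t] by blast
  fix T' F' assume "(T', F') \<in> s_tors D H" and le: "tors_le D (T, F) (T', F')"
  then have t': "torsion_pair D H (T', F')" using s_tors_iff by blast
  have "?U \<subseteq> star D A1 T'"
    using torsion_pair_ambient(1)[OF psi_torsion_pair[OF t']] psi_orth(1)[OF t t' le] star_Ob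
    unfolding lperp_def by blast
  then show "t_str_le (?U, ?W) (star D A1 T', star D (shift_subcat D 1 F') (snd s2))"
    by (simp add: t_str_le_def)
qed

end

theorem corollary3p11:
  fixes D :: "('o, 'm) tricat" and s1 s2 :: "'o set \<times> 'o set"
  assumes "triangulated_category D"
    and "t_structure D s1"
    and "t_structure D s2"
    and "fst s1 \<subseteq> fst s2"
  shows
    "inverse_order_bijections
       (tors_interval D s1 s2) (tors_le D)
       (tors D (interval_heart D s1 s2)) (tors_le D)
       (\<lambda>(U, V). (U \<inter> tge D s1 1, V \<inter> fst s2))
       (\<lambda>(T, F). (star D (fst s1) T, star D F (tge D s2 1)))
     \<and>
     inverse_order_bijections
       (t_str_interval D s1 s2) t_str_le
       (s_tors D (interval_heart D s1 s2)) (tors_le D)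
       (\<lambda>(U, V). (U \<inter> tge D s1 1, tge D (U, V) 1 \<inter> fst s2))
       (\<lambda>(T, F). (star D (fst s1) T, star D (shift_subcat D 1 F) (snd s2)))"
proof -
  interpret t_structure_interval D s1 s2
    using assms by (simp add: t_structure_interval_def t_structure_interval_axioms_def)
  show ?thesis using tors_interval_bijection t_str_interval_bijection by blast
qed

end
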